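(* Let $\mathcal{P}$ and $\mathcal{Q}$ be a pair of compactness-like topological properties. Let $X$ be a Tychonoff locally-$\mathcal P$ non-$\mathcal P$ space with $\mathcal{Q}$. Consider the subspace $\zeta_{\mathcal P}X=X\cup(\beta X\setminus\lambda_{\mathcal P}X)$ of $\beta X$. Then (1) $\zeta_{\mathcal P}X$ is the largest element (with respect to $\le$) of each of $\mathscr{E}^{\mathcal Q}_{\mathcal P}(X)$, $\mathscr{M}^{\mathcal Q}_{\mathcal P}(X)$ and $\mathscr{O}^{\mathcal Q}_{\mathcal P}(X)$. (2) For any $Y\in\mathscr{E}^{\mathcal Q}_{\mathcal P}(X)$ consider the following properties: (a) For any $S,Z\in\mathscr Z(X)$ where $S\cap Z\subseteq C$ for some $C\in Coz(X)$ such that $\mathrm{cl}_XC$ has $\mathcal P$, we have $\mathrm{cl}_YS\cap\mathrm{cl}_YZ\subseteq X$. (b) $Y$ satisfies the following: (i) for any $S,Z\in\mathscr Z(X)$ we have $\mathrm{cl}_Y(S\cap Z)\setminus X=(\mathrm{cl}_YS\cap\mathrm{cl}_YZ)\setminus X$; and (ii) for any $Z\in\mathscr Z(X)$ where $Z\subseteq C$ for some $C\in Coz(X)$ such that $\mathrm{cl}_XC$ has $\mathcal P$, we have $\mathrm{cl}_YZ\subseteq X$. Then $\zeta_{\mathcal P}X$ is characterized in $\mathscr{E}^{\mathcal Q}_{\mathcal P}(X)$ by either of the properties (a) and (b); that is, for $Y\in\mathscr{E}^{\mathcal Q}_{\mathcal P}(X)$, $Y=\zeta_{\mathcal P}X$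 (as extensions of $X$) if and only if $Y$ satisfies (a), and if and only if $Y$ satisfies (b).
   Context: Conventions: compact spaces and Tychonoff spaces are Hausdorff. Topological properties are assumed to be satisfied by at least one space. A mapping $f:X\to Y$ is perfect if $X$ is Hausdorff and $f$ is continuous, closed (not necessarily surjective) and has compact fibers. A topological property $\mathcal{P}$ is invariant (inverse invariant) under perfect mappings if for every perfect surjective $f:X\to Y$, $Y$ has $\mathcal P$ whenever $X$ does ($X$ has $\mathcal P$ whenever $Y$ does); it is perfect if both hold. $\mathcal P$ is clopen hereditary if every clopen subset of a space with $\mathcal P$ has $\mathcal P$; finitely additive if $X_1\oplus\cdots\oplus X_n$ has $\mathcal P$ whenever every $X_i$ does. $\mathcal P$ satisfies Mrówka's condition (W) if: whenever $X$ is a Tychonoff space having a point $p$ with an open base $\mathscr B$ for $X$ at $p$ such that $X\setminus B$ has $\mathcal P$ for every $B\in\mathscr B$, then $X$ has $\mathcal P$. $\mathcal P$ is compactness-like if it is clopen hereditary, finitely additive, perfect and satisfies (W). "$\mathcal P$ and $\mathcal Q$ is a pair of compactness-like topological properties" (order matters) means: $\mathcal P$ is compactness-like, and $\mathcal Q$ is clopen hereditary, inverse invariant under perfect mappings and satisfies (W). $X$ is locally-$\mathcal P$ if each $x\in X$ has an open neighborhood $U$ with $\mathrm{cl}_XU$ having $\mathcal P$. A space $Y$ is an extension of $X$ if it contains $X$ as a dense subspace; $Y\setminus X$ is its remainder. Extensions are identified when there is a homeomorphism between them fixing $X$ pointwise. $Y\le Y'$ means there is a continuous map $Y'\to Y$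 fixing $X$ pointwise. $\mathscr E(X)$ is the set of all Tychonoff extensions of $X$ with compact remainder; $\mathscr E_{\mathcal P}(X)=\mathscr E^{\mathcal P}(X)$ is the set of elements of $\mathscr E(X)$ having $\mathcal P$; $\mathscr E^{\mathcal Q}_{\mathcal P}(X)=\mathscr E^{\mathcal Q}(X)\cap\mathscr E_{\mathcal P}(X)$. A minimal $\mathcal P$-extension of $X$ is a $Y\in\mathscr E_{\mathcal P}(X)$ which does not properly contain (as a subspace) any other element of $\mathscr E_{\mathcal P}(X)$. An optimal $\mathcal P$-extension of $X$ is a minimal $\mathcal P$-extension $Y$ whose topology is moreover maximal (with respect to inclusion) among all topologies on the set $Y$ which turn $Y$ into an element of $\mathscr E_{\mathcal P}(X)$. $\mathscr M_{\mathcal P}(X)$, $\mathscr O_{\mathcal P}(X)$ are the sets of minimal, respectively optimal, $\mathcal P$-extensions; $\mathscr M^{\mathcal Q}_{\mathcal P}(X)=\mathscr E^{\mathcal Q}(X)\cap\mathscr M_{\mathcal P}(X)$ and $\mathscr O^{\mathcal Q}_{\mathcal P}(X)=\mathscr E^{\mathcal Q}(X)\cap\mathscr O_{\mathcal P}(X)$. A zero-set of $X$ is a set $f^{-1}(0)$ with $f:X\to[0,1]$ continuous; a cozero-set is the complement of a zero-set; $\mathscr Z(X)$, $Coz(X)$ are the sets of all zero-sets, cozero-sets of $X$. $\beta X$ is the Stone–Čech compactification, and $\lambda_{\mathcal P}X=\bigcup\{\mathrm{int}_{\beta X}\mathrm{cl}_{\beta X}Z: Z\in\mathscr Z(X)\text{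 has }\mathcal P\}$. *)

theory Defs
  imports "HOL-Analysis.Analysis"
begin

(* A topological property is a homeomorphism-invariant predicate on the topologies whose points lie
   in a type 'u.  HOL cannot quantify over types inside a formula, so 'u serves as the universe of
   all spaces, and the closure conditions on a property range over spaces in 'u.  Since 'u is a type
   variable, a statement about all such predicates covers universes of any size. *)

definition Tychonoff_space :: "'u topology \<Rightarrow> bool" where
  "Tychonoff_space X \<longleftrightarrow> completely_regular_space X \<and> Hausdorff_space X"

definition topological_property :: "('u topology \<Rightarrow> bool) \<Rightarrow> bool" where
  "topological_property P \<longleftrightarrow>
     (\<forall>X Y. X homeomorphic_space Y \<longrightarrow> P X \<longrightarrow> P Y) \<and> (\<exists>X. P X)"

definition perfect_invariant :: "('u topology \<Rightarrow> bool) \<Rightarrow> bool" where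
  "perfect_invariant P \<longleftrightarrow>
     (\<forall>X Y f. Hausdorff_space X \<and> perfect_map X Y f \<and> P X \<longrightarrow> P Y)"

definition perfect_inverse_invariant :: "('u topology \<Rightarrow> bool) \<Rightarrow> bool" where
  "perfect_inverse_invariant P \<longleftrightarrow>
     (\<forall>X Y f. Hausdorff_space X \<and> perfect_map X Y f \<and> P Y \<longrightarrow> P X)"

definition perfect_property :: "('u topology \<Rightarrow> bool) \<Rightarrow> bool" where
  "perfect_property P \<longleftrightarrow> perfect_invariant P \<and> perfect_inverse_invariant P"

definition clopen_hereditary :: "('u topology \<Rightarrow> bool) \<Rightarrow> bool" where
  "clopen_hereditary P \<longleftrightarrow>
     (\<forall>X U. P X \<and> openin X U \<and> closedin X U \<longrightarrow> P (subtopology X U))"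

(* The library's direct sum lives on a product type, so the sum is represented by an arbitrary
   homeomorphic copy S of it in the universe. *)
definition finitely_additive :: "('u topology \<Rightarrow> bool) \<Rightarrow> bool" where
  "finitely_additive P \<longleftrightarrow>
     (\<forall>(n::nat) (X :: nat \<Rightarrow> 'u topology) S.
        1 \<le> n \<and> (\<forall>i\<in>{1..n}. P (X i)) \<and> S homeomorphic_space sum_topology X {1..n} \<longrightarrow> P S)"

definition open_base_at :: "'u topology \<Rightarrow> 'u \<Rightarrow> 'u set set \<Rightarrow> bool" where
  "open_base_at X p \<B> \<longleftrightarrow>
     (\<forall>B\<in>\<B>. openin X B \<and> p \<in> B) \<and> (\<forall>U. openin X U \<and> p \<in> U \<longrightarrow> (\<exists>B\<in>\<B>. B \<subseteq> U))"

definition Mrowka_W :: "('u topology \<Rightarrow> bool) \<Rightarrow> bool" where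
  "Mrowka_W P \<longleftrightarrow>
     (\<forall>X p \<B>. Tychonoff_space X \<and> p \<in> topspace X \<and> open_base_at X p \<B> \<and>
        (\<forall>B\<in>\<B>. P (subtopology X (topspace X - B))) \<longrightarrow> P X)"

definition compactness_like :: "('u topology \<Rightarrow> bool) \<Rightarrow> bool" where
  "compactness_like P \<longleftrightarrow>
     topological_property P \<and> clopen_hereditary P \<and> finitely_additive P \<and>
     perfect_property P \<and> Mrowka_W P"

definition compactness_like_pair ::
  "('u topology \<Rightarrow> bool) \<Rightarrow> ('u topology \<Rightarrow> bool) \<Rightarrow> bool" where
  "compactness_like_pair P Q \<longleftrightarrow>
     compactness_like P \<and>
     topological_property Q \<and> clopen_hereditary Q \<and> perfect_inverse_invariant Q \<and> Mrowka_W Q"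

definition locally_property :: "('u topology \<Rightarrow> bool) \<Rightarrow> 'u topology \<Rightarrow> bool" where
  "locally_property P X \<longleftrightarrow>
     (\<forall>x\<in>topspace X. \<exists>U. openin X U \<and> x \<in> U \<and> P (subtopology X (X closure_of U)))"


(* Extensions contain X literally.  The collections below consist of all representatives, i.e. they
   are closed under ext_equiv (within the universe) rather than quotiented by it. *)

definition extension_of :: "'u topology \<Rightarrow> 'u topology \<Rightarrow> bool" where
  "extension_of X Y \<longleftrightarrow>
     subtopology Y (topspace X) = X \<and> Y closure_of (topspace X) = topspace Y"

definition ext_equiv :: "'u topology \<Rightarrow> 'u topology \<Rightarrow> 'u topology \<Rightarrow> bool" where
  "ext_equiv X Y Y' \<longleftrightarrow> (\<exists>h. homeomorphic_map Y Y' h \<and> (\<forall>x\<in>topspace X. h x = x))"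

definition ext_le :: "'u topology \<Rightarrow> 'u topology \<Rightarrow> 'u topology \<Rightarrow> bool" where
  "ext_le X Y Y' \<longleftrightarrow> (\<exists>f. continuous_map Y' Y f \<and> (\<forall>x\<in>topspace X. f x = x))"

definition largest_ext :: "'u topology \<Rightarrow> 'u topology set \<Rightarrow> 'u topology \<Rightarrow> bool" where
  "largest_ext X \<E> Y \<longleftrightarrow> Y \<in> \<E> \<and> (\<forall>Y'\<in>\<E>. ext_le X Y' Y)"

definition Ext :: "'u topology \<Rightarrow> 'u topology set" where
  "Ext X = {Y. extension_of X Y \<and> Tychonoff_space Y \<and> compactin Y (topspace Y - topspace X)}"

definition Ext_P :: "('u topology \<Rightarrow> bool) \<Rightarrow> 'u topology \<Rightarrow> 'u topology set" where
  "Ext_P P X = {Y \<in> Ext X. P Y}"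

definition Min_P :: "('u topology \<Rightarrow> bool) \<Rightarrow> 'u topology \<Rightarrow> 'u topology set" where
  "Min_P P X =
     {Y \<in> Ext_P P X. \<not> (\<exists>Z\<in>Ext_P P X. topspace Z \<subset> topspace Y \<and> subtopology Y (topspace Z) = Z)}"

definition Opt_P :: "('u topology \<Rightarrow> bool) \<Rightarrow> 'u topology \<Rightarrow> 'u topology set" where
  "Opt_P P X =
     {Y \<in> Min_P P X. \<forall>T\<in>Ext_P P X.
        topspace T = topspace Y \<and> (\<forall>U. openin Y U \<longrightarrow> openin T U) \<longrightarrow> T = Y}"

definition Ext_PQ where "Ext_PQ P Q X = Ext_P Q X \<inter> Ext_P P X"
definition Min_PQ where "Min_PQ P Q X = Ext_P Q X \<inter> Min_P P X"
definition Opt_PQ where "Opt_PQ P Q X = Ext_P Q X \<inter> Opt_P P X"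


definition zero_sets :: "'u topology \<Rightarrow> 'u set set" where
  "zero_sets X = {{x \<in> topspace X. f x = (0::real)} | f. continuous_map X (top_of_set {0..1}) f}"

definition cozero_sets :: "'u topology \<Rightarrow> 'u set set" where
  "cozero_sets X = {topspace X - Z | Z. Z \<in> zero_sets X}"

(* bX is (a representative of) the Stone-Cech compactification of X: the compactification, unique up
   to ext_equiv, to which every continuous map from X to [0,1] extends. *)
definition stone_cech :: "'u topology \<Rightarrow> 'u topology \<Rightarrow> bool" where
  "stone_cech X bX \<longleftrightarrow>
     extension_of X bX \<and> compact_space bX \<and> Hausdorff_space bX \<and>
     (\<forall>f::'u \<Rightarrow> real. continuous_map X (top_of_set {0..1}) f \<longrightarrow>
        (\<exists>g. continuous_map bX (top_of_set {0..1}) g \<and> (\<forall>x\<in>topspace X. g x = f x)))"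

definition lambda_P :: "('u topology \<Rightarrow> bool) \<Rightarrow> 'u topology \<Rightarrow> 'u topology \<Rightarrow> 'u set" where
  "lambda_P P X bX =
     \<Union>{bX interior_of (bX closure_of Z) | Z. Z \<in> zero_sets X \<and> P (subtopology X Z)}"

definition zeta_P :: "('u topology \<Rightarrow> bool) \<Rightarrow> 'u topology \<Rightarrow> 'u topology \<Rightarrow> 'u topology" where
  "zeta_P P X bX = subtopology bX (topspace X \<union> (topspace bX - lambda_P P X bX))"

definition within_P_cozero :: "('u topology \<Rightarrow> bool) \<Rightarrow> 'u topology \<Rightarrow> 'u set \<Rightarrow> bool" where
  "within_P_cozero P X A \<longleftrightarrow>
     (\<exists>C\<in>cozero_sets X. A \<subseteq> C \<and> P (subtopology X (X closure_of C)))"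

definition property_a :: "('u topology \<Rightarrow> bool) \<Rightarrow> 'u topology \<Rightarrow> 'u topology \<Rightarrow> bool" where
  "property_a P X Y \<longleftrightarrow>
     (\<forall>S\<in>zero_sets X. \<forall>Z\<in>zero_sets X. within_P_cozero P X (S \<inter> Z) \<longrightarrow>
        Y closure_of S \<inter> Y closure_of Z \<subseteq> topspace X)"

definition property_b :: "('u topology \<Rightarrow> bool) \<Rightarrow> 'u topology \<Rightarrow> 'u topology \<Rightarrow> bool" where
  "property_b P X Y \<longleftrightarrow>
     (\<forall>S\<in>zero_sets X. \<forall>Z\<in>zero_sets X.
        Y closure_of (S \<inter> Z) - topspace X = (Y closure_of S \<inter> Y closure_of Z) - topspace X) \<and>
     (\<forall>Z\<in>zero_sets X. within_P_cozero P X Z \<longrightarrow> Y closure_of Z \<subseteq> topspace X)"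


(* Every Tychonoff space has, up to homeomorphism, a Stone-Cech compactification in a large enough
   universe.  Every Tychonoff extension of X with compact remainder K is then represented there as
   well, because K is an image of a subset of bX - X. *)
lemma stone_cech_exists:
  fixes X :: "'a topology"
  assumes X: "Tychonoff_space X"
  shows "\<exists>X' bX :: (('a \<Rightarrow> real) \<Rightarrow> real) topology. X homeomorphic_space X' \<and> stone_cech X' bX"
proof -
  define K where "K \<equiv> mspace (submetric (cfunspace X euclidean_metric)
                        {f. f \<in> topspace X \<rightarrow> {0..1::real}})"
  define e where "e \<equiv> \<lambda>x. \<lambda>f\<in>K. f x"
  define cube where "cube \<equiv> product_topology (\<lambda>f. top_of_set {0..1::real}) K"
  have emb: "embedding_map X cube e"
    unfolding cube_def e_def K_def
    by (rule completely_regular_space_cube_embedding_explicit)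
      (use X in \<open>simp_all add: Tychonoff_space_def\<close>)
  define X' where "X' \<equiv> subtopology cube (e ` topspace X)"
  define bX where "bX \<equiv> subtopology cube (cube closure_of (e ` topspace X))"
  have hom: "homeomorphic_map X X' e"
    using emb by (simp add: embedding_map_def X'_def)
  have sub: "e ` topspace X \<subseteq> topspace cube"
    using homeomorphic_imp_continuous_map[OF hom]
    by (simp add: X'_def continuous_map_in_subtopology continuous_map_image_subset_topspace)
  have cl: "e ` topspace X \<subseteq> cube closure_of (e ` topspace X)"
    by (simp add: closure_of_subset sub)
  have tX': "topspace X' = e ` topspace X"
    using sub by (auto simp: X'_def)
  have compc: "compact_space cube"
    unfolding cube_def
    using compact_space_product_topology compact_space_subtopology compactin_euclidean_iff by blast
  have Hc: "Hausdorff_space cube"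
    unfolding cube_def
    using Hausdorff_space_euclidean Hausdorff_space_product_topology Hausdorff_space_subtopology by blast
  have "subtopology bX (topspace X') = X'"
    unfolding tX' by (simp add: bX_def X'_def subtopology_subtopology Int_absorb1 cl)
  moreover have "bX closure_of (topspace X') = topspace bX"
    unfolding tX' using closure_of_subset_topspace[of cube]
    by (simp add: bX_def closure_of_subtopology Int_absorb1 Int_absorb2 cl)
  ultimately have "extension_of X' bX"
    by (simp add: extension_of_def)
  moreover have "compact_space bX"
    unfolding bX_def
    by (intro compact_space_subtopology closedin_compact_space compc closedin_closure_of)
  moreover have "Hausdorff_space bX"
    using Hc by (simp add: bX_def Hausdorff_space_subtopology)
  moreover have "\<exists>g. continuous_map bX (top_of_set {0..1}) g \<and> (\<forall>y\<in>topspace X'. g y = f y)"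
    if f: "continuous_map X' (top_of_set {0..1}) f" for f :: "_ \<Rightarrow> real"
  proof -
    define k where "k \<equiv> restrict (f \<circ> e) (topspace X)"
    have c: "continuous_map X (top_of_set {0..1}) (f \<circ> e)"
      by (rule continuous_map_compose[OF homeomorphic_imp_continuous_map[OF hom] f])
    then have c1: "continuous_map X euclideanreal (f \<circ> e)" and c2: "f \<circ> e \<in> topspace X \<rightarrow> {0..1}"
      by (auto simp: continuous_map_in_subtopology)
    then have "bounded ((f \<circ> e) ` topspace X)"
      by (metis bounded_closed_interval bounded_subset image_subset_iff_funcset)
    with c1 c2 have kK: "k \<in> K"
      by (auto simp: K_def k_def)
    have "continuous_map cube (top_of_set {0..1}) (\<lambda>y. y k)"
      unfolding cube_def using kK by (rule continuous_map_product_projection)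
    then have "continuous_map bX (top_of_set {0..1}) (\<lambda>y. y k)"
      unfolding bX_def by (rule continuous_map_from_subtopology)
    moreover have "y k = f y" if y: "y \<in> topspace X'" for y
    proof -
      obtain x where x: "y = e x" "x \<in> topspace X"
        using y unfolding tX' by (rule imageE)
      have "e x k = k x"
        unfolding e_def using kK by (rule restrict_apply')
      then show ?thesis
        by (simp only: x k_def restrict_apply' o_apply)
    qed
    ultimately show ?thesis
      by (intro exI[of _ "\<lambda>y. y k"]) simp
  qed
  ultimately have "stone_cech X' bX"
    by (simp add: stone_cech_def)
  then show ?thesis
    using homeomorphic_map_imp_homeomorphic_space[OF hom] by blast
qed

end

theory Submission
  imports Defs
begin

text \<open>
  The remainder of \<open>\<zeta>\<close>, the complement of \<open>\<lambda>\<close> in \<open>\<beta>X\<close>, is compact, and a closed subset of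
  \<open>\<zeta>\<close> missing it has its \<open>\<beta>X\<close>-closure covered by finitely many of the open sets making up \<open>\<lambda>\<close>,
  hence has \<open>P\<close>.  Collapsing the remainder to a point and applying (W) shows that \<open>\<zeta>\<close> has \<open>P\<close>, and
  likewise \<open>Q\<close>.  Conversely, let \<open>Y\<close> be an extension with \<open>P\<close> and compact remainder, embedded in a
  compact space \<open>C\<close>, and let \<open>F : \<beta>X \<rightarrow> C\<close> extend the inclusion of \<open>X\<close>.  If \<open>F t\<close> were outside
  \<open>Y - X\<close>, a function separating it from \<open>Y - X\<close> would give a zero-set of \<open>X\<close> which is closed in
  \<open>Y\<close>, so has \<open>P\<close>, and whose \<open>\<beta>X\<close>-closure is a neighbourhood of \<open>t\<close>; so \<open>t \<in> \<lambda>\<close>.  Thus \<open>F\<close>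
  maps \<open>\<beta>X - \<lambda>\<close> into \<open>Y - X\<close>, which gives that \<open>\<zeta>\<close> is largest, minimal and optimal.  Property (a)
  forces \<open>F\<close> to map \<open>\<lambda> - X\<close> off \<open>Y\<close> and to be injective on \<open>\<beta>X - \<lambda>\<close>, so that \<open>F\<close> restricts to a
  homeomorphism of \<open>\<zeta>\<close> onto \<open>Y\<close>.
\<close>

subsection \<open>Closed subspaces and finite closed unions\<close>

text \<open>The final topology of \<open>f\<close>. It provides both copies of spaces inside the
  universe and the collapse of a compact set.\<close>

lemma quotient_topology_exists:
  fixes X :: "'a topology" and f :: "'a \<Rightarrow> 'b"
  shows "\<exists>T. quotient_map X T f"
proof -
  define L where "L U \<longleftrightarrow> U \<subseteq> f ` topspace X \<and> openin X {x \<in> topspace X. f x \<in> U}" for U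
  have "istopology L"
    unfolding istopology_def
  proof (intro conjI allI impI)
    fix S T
    assume "L S" "L T"
    moreover have "{x \<in> topspace X. f x \<in> S \<inter> T} = {x \<in> topspace X. f x \<in> S} \<inter> {x \<in> topspace X. f x \<in> T}"
      by auto
    ultimately show "L (S \<inter> T)"
      unfolding L_def by (metis (no_types, lifting) inf.coboundedI1 openin_Int)
  next
    fix K
    assume "\<forall>S\<in>K. L S"
    moreover have "{x \<in> topspace X. f x \<in> \<Union>K} = (\<Union>S\<in>K. {x \<in> topspace X. f x \<in> S})"
      by auto
    ultimately show "L (\<Union>K)"
      unfolding L_def by (auto intro!: openin_Union)
  qed
  then have op: "openin (topology L) U \<longleftrightarrow> L U" for U
    by (simp add: topology_inverse')
  have "{x \<in> topspace X. f x \<in> f ` topspace X} = topspace X"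
    by auto
  then have "L (f ` topspace X)"
    by (simp add: L_def)
  then have "openin (topology L) (f ` topspace X)"
    by (simp add: op)
  moreover have "topspace (topology L) \<subseteq> f ` topspace X"
    using openin_topspace[of "topology L"] unfolding op by (simp add: L_def)
  ultimately have "topspace (topology L) = f ` topspace X"
    by (intro subset_antisym openin_subset)
  then have "quotient_map X (topology L) f"
    by (simp add: quotient_map_def op L_def)
  then show ?thesis ..
qed

text \<open>An injective quotient map is a homeomorphism.\<close>

lemma injective_copy_exists:
  assumes "inj f"
  obtains T where "homeomorphic_map X T f"
  using quotient_topology_exists[of X f] assms
  by (metis homeomorphic_map_def inj_on_subset subset_UNIV)

text \<open>An infinite type absorbs its square; \<open>i\<close> turns the index into an element of
  it, so that an indexed point is coded as a point.\<close>

lemma inj_nat_times: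
  assumes "infinite (UNIV :: 'u set)"
  obtains j :: "nat \<times> 'u \<Rightarrow> 'u" where "inj j"
proof -
  obtain i :: "nat \<Rightarrow> 'u" where i: "inj i"
    using infinite_countable_subset[OF assms] by auto
  obtain g :: "'u \<times> 'u \<Rightarrow> 'u" where "bij_betw g (UNIV \<times> UNIV) UNIV"
    using card_of_Times_same_infinite[OF assms] card_of_ordIso by blast
  then have g: "inj g"
    by (simp add: bij_betw_def)
  have "inj (\<lambda>(n, x). g (i n, x))"
    by (rule injI) (auto dest!: injD[OF g] injD[OF i])
  then show thesis ..
qed

text \<open>
  Finite sums are not available inside the universe \<^typ>\<open>'u\<close> in general, but for infinite \<^typ>\<open>'u\<close>
  they have copies there.
\<close>

lemma two_closed_sum:
  fixes X :: "'u topology"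
  assumes inf: "infinite (UNIV :: 'u set)" and HX: "Hausdorff_space X"
    and cl: "closedin X A" "closedin X B"
  obtains S :: "'u topology" and f U
  where "S homeomorphic_space sum_topology (\<lambda>i. subtopology X (if i = 1 then A else B)) {1..2::nat}"
    "Hausdorff_space S" "perfect_map S (subtopology X (A \<union> B)) f"
    "openin S U" "closedin S U" "subtopology S U homeomorphic_space subtopology X B"
proof -
  let ?Z = "\<lambda>i::nat. if i = 1 then A else B"
  let ?S = "sum_topology (\<lambda>i. subtopology X (?Z i)) {1..2::nat}"
  have sub: "A \<subseteq> topspace X" "B \<subseteq> topspace X"
    using cl closedin_subset by auto
  have tS: "topspace ?S = Sigma {1..2} ?Z"
    using sub by (auto split: if_splits)
  obtain j :: "nat \<times> 'u \<Rightarrow> 'u" where "inj j"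
    using inj_nat_times[OF inf] .
  then obtain S where S: "homeomorphic_map ?S S j"
    using injective_copy_exists by metis
  obtain k where k: "homeomorphic_map S ?S k"
    using S homeomorphic_map_imp_homeomorphic_space homeomorphic_space homeomorphic_space_sym by meson
  have I12: "{1..2::nat} = {1,2}"
    by auto
  have cont: "continuous_map ?S X snd"
  proof -
    have "openin (subtopology X (?Z i)) {x. (i, x) \<in> {z \<in> Sigma {1..2} ?Z. snd z \<in> V}}"
      if "openin X V" "i \<in> {1..2}" for V i
    proof -
      have "{x. (i, x) \<in> {z \<in> Sigma {1..2} ?Z. snd z \<in> V}} = V \<inter> ?Z i"
        using that by auto
      then show ?thesis
        using that(1) by (auto simp: openin_subtopology_Int)
    qed
    then show ?thesis
      using sub unfolding continuous_map_def tS openin_sum_topology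
      by (auto simp: Pi_iff split: if_splits)
  qed
  \<comment> \<open>The image of a closed set is the union of its two slices, closed in
    \<open>X\<close> because \<open>A\<close> and \<open>B\<close> are.\<close>
  have closed: "closed_map ?S X snd"
    unfolding closed_map_def
  proof (intro allI impI)
    fix U assume U: "closedin ?S U"
    then have "closedin (subtopology X (?Z i)) {x. (i, x) \<in> U}" if "i \<in> {1..2}" for i
      using that by (simp add: closedin_sum_topology)
    from this[of 1] this[of 2] have "closedin X {x. (1, x) \<in> U}" "closedin X {x. (2, x) \<in> U}"
      using cl by (simp_all add: closedin_closed_subtopology)
    moreover have "snd ` U = {x. (1, x) \<in> U} \<union> {x. (2, x) \<in> U}"
      using closedin_subset[OF U] unfolding tS unfolding I12 by (auto intro: rev_image_eqI)
    ultimately show "closedin X (snd ` U)"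
      by (simp add: closedin_Un)
  qed
  have img: "snd ` topspace ?S = A \<union> B"
    unfolding tS unfolding I12 by (auto simp: snd_image_Sigma)
  have HS: "Hausdorff_space ?S"
    unfolding Hausdorff_space_def
  proof (intro allI impI, elim conjE)
    fix x y assume x: "x \<in> topspace ?S" and y: "y \<in> topspace ?S" and "x \<noteq> y"
    show "\<exists>U V. openin ?S U \<and> openin ?S V \<and> x \<in> U \<and> y \<in> V \<and> disjnt U V"
    proof (cases "fst x = fst y")
      case True
      with \<open>x \<noteq> y\<close> have "snd x \<noteq> snd y"
        by (simp add: prod_eq_iff)
      moreover have "snd x \<in> topspace X" "snd y \<in> topspace X"
        using x y continuous_map_image_subset_topspace[OF cont] by auto
      ultimately obtain U V where UV: "openin X U" "openin X V" "snd x \<in> U" "snd y \<in> V" "disjnt U V"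
        using HX unfolding Hausdorff_space_def by metis
      let ?W = "\<lambda>U. {z \<in> topspace ?S. snd z \<in> U}"
      have "openin ?S (?W U)" "openin ?S (?W V)"
        using UV openin_continuous_map_preimage[OF cont] by blast+
      moreover have "x \<in> ?W U" "y \<in> ?W V" "disjnt (?W U) (?W V)"
        using UV x y by (auto simp: disjnt_iff)
      ultimately show ?thesis
        by blast
    next
      case False
      \<comment> \<open>Points with different tags are separated by the summands themselves;
        \<open>?W n\<close> is the \<open>n\<close>-th one.\<close>
      let ?W = "\<lambda>n. Sigma {1..2} (\<lambda>i. if i = n then ?Z i else {})"
      have "openin ?S (?W n)" for n
        unfolding openin_disjoint_union using sub by (auto simp: openin_subtopology)
      moreover have "x \<in> ?W (fst x)" "y \<in> ?W (fst y)"
        using x y unfolding tS by (auto simp: mem_Sigma_iff split_def)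
      moreover have "disjnt (?W (fst x)) (?W (fst y))"
        using False by (auto simp: disjnt_iff)
      ultimately show ?thesis
        by blast
    qed
  qed
  have "compactin ?S {z \<in> topspace ?S. snd z = y}" for y
  proof -
    have "{z \<in> topspace ?S. snd z = y} \<subseteq> {(1,y), (2,y)}"
      unfolding tS unfolding I12 by auto
    then have "finite {z \<in> topspace ?S. snd z = y}"
      by (rule finite_subset) simp
    then show ?thesis
      by (intro finite_imp_compactin) auto
  qed
  then have perf: "perfect_map ?S (subtopology X (A \<union> B)) snd"
    unfolding perfect_map_def proper_map_def
    using cont closed img sub closed_map_into_subtopology[OF closed, of "A \<union> B"]
    by (auto simp: continuous_map_in_subtopology image_subset_iff_funcset[symmetric])
  let ?U = "{(2::nat, x) | x. x \<in> B}"
  have "openin ?S ?U" "closedin ?S ?U"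
    using sub by (auto simp: openin_sum_topology closedin_sum_topology openin_subtopology_refl closedin_subtopology_refl)
  have "embedding_map (subtopology X (?Z 2)) ?S (\<lambda>x. (2,x))"
    by (rule embedding_map_component_injection[where X = "\<lambda>i. subtopology X (?Z i)"]) auto
  then have "subtopology X B homeomorphic_space subtopology ?S ?U"
    using sub homeomorphic_map_imp_homeomorphic_space
    by (fastforce simp: embedding_map_def Int_absorb1 Setcompr_eq_image)
  moreover have "subtopology ?S ?U homeomorphic_space subtopology S (j ` ?U)"
  proof -
    have "homeomorphic_map (subtopology ?S ?U) (subtopology S (j ` ?U)) j"
      by (rule homeomorphic_map_subtopologies[OF S])
         (use \<open>openin ?S ?U\<close> openin_subset homeomorphic_imp_surjective_map[OF S] in blast)
    then show ?thesis
      by (rule homeomorphic_map_imp_homeomorphic_space)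
  qed
  ultimately have hom: "subtopology S (j ` ?U) homeomorphic_space subtopology X B"
    using homeomorphic_space_sym homeomorphic_space_trans by blast
  show thesis
  proof (rule that[OF _ _ _ _ _ hom])
    show "S homeomorphic_space ?S"
      using k homeomorphic_map_imp_homeomorphic_space by blast
    then show "Hausdorff_space S"
      using HS homeomorphic_Hausdorff_space by blast
    show "perfect_map S (subtopology X (A \<union> B)) (snd \<circ> k)"
      using perfect_map_compose[OF homeomorphic_imp_perfect_map[OF k] perf] .
    show "openin S (j ` ?U)" "closedin S (j ` ?U)"
      using \<open>openin ?S ?U\<close> \<open>closedin ?S ?U\<close> S
      by (meson homeomorphic_eq_everything_map open_map_def closed_map_def)+
  qed
qed

text \<open>
  A closed \<open>A\<close> is clopen in the sum of \<open>X\<close> and \<open>A\<close>, which maps perfectly onto \<open>X\<close>.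
\<close>

lemma closed_hereditary:
  fixes X :: "'u topology"
  assumes "infinite (UNIV :: 'u set)" "topological_property R" "clopen_hereditary R"
    "perfect_inverse_invariant R" "Hausdorff_space X" "R X" "closedin X A"
  shows "R (subtopology X A)"
proof -
  obtain S :: "'u topology" and f U where
    "S homeomorphic_space sum_topology (\<lambda>i. subtopology X (if i = 1 then topspace X else A)) {1..2::nat}"
    and S: "Hausdorff_space S" "perfect_map S (subtopology X (topspace X \<union> A)) f"
    "openin S U" "closedin S U" "subtopology S U homeomorphic_space subtopology X A"
    by (rule two_closed_sum[OF assms(1,5) closedin_topspace assms(7)])
  have "subtopology X (topspace X \<union> A) = X"
    by (simp add: subtopology_superset)
  then have "R S"
    using S(1,2) assms(4,6) unfolding perfect_inverse_invariant_def by auto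
  then have "R (subtopology S U)"
    using S(3,4) assms(3) unfolding clopen_hereditary_def by blast
  then show ?thesis
    using S(5) assms(2) unfolding topological_property_def by blast
qed

text \<open>The sum of \<open>A\<close> and \<open>B\<close> maps perfectly onto
  \<open>A \<union> B\<close>, whether or not they overlap.\<close>

lemma closed_additive:
  fixes X :: "'u topology"
  assumes inf: "infinite (UNIV :: 'u set)" and "finitely_additive R" "perfect_invariant R"
    and "Hausdorff_space X" "closedin X A" "closedin X B"
    and RA: "R (subtopology X A)" and RB: "R (subtopology X B)"
  shows "R (subtopology X (A \<union> B))"
proof -
  obtain S :: "'u topology" and f U where
    S: "S homeomorphic_space sum_topology (\<lambda>i. subtopology X (if i = 1 then A else B)) {1..2::nat}"
    "Hausdorff_space S" "perfect_map S (subtopology X (A \<union> B)) f"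
    and "openin S U" "closedin S U" "subtopology S U homeomorphic_space subtopology X B"
    by (rule two_closed_sum[OF inf assms(4-6)])
  have "R S"
    by (rule assms(2)[unfolded finitely_additive_def, rule_format,
          of 2 "\<lambda>i. subtopology X (if i = 1 then A else B)"])
      (use S(1) RA RB in auto)
  with S assms(3) show ?thesis
    unfolding perfect_invariant_def by blast
qed

text \<open>Some space has \<open>R\<close>, and the empty set is clopen in it.\<close>

lemma property_empty:
  assumes "topological_property R" "clopen_hereditary R"
  shows "R trivial_topology"
proof -
  obtain Y where "R Y"
    using assms(1) unfolding topological_property_def by blast
  then have "R (subtopology Y {})"
    using assms(2) openin_empty closedin_empty unfolding clopen_hereditary_def by metis
  then show ?thesis
    by simp
qed

text \<open>(W) gives \<open>R\<close> to a one-point space, where the complement of the only base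
  set is empty; a nonempty compact Hausdorff space maps perfectly onto it.\<close>

lemma compact_imp_property:
  assumes R: "topological_property R" "clopen_hereditary R" "perfect_inverse_invariant R" "Mrowka_W R"
    and K: "compact_space K" "Hausdorff_space K"
  shows "R K"
proof (cases "topspace K = {}")
  case True
  then show ?thesis
    using property_empty[OF R(1,2)] by (simp add: null_topspace_iff_trivial)
next
  case False
  then obtain p where p: "p \<in> topspace K"
    by blast
  let ?T = "discrete_topology {p}"
  have "Tychonoff_space ?T"
    by (simp add: Tychonoff_space_def completely_regular_space_discrete_topology)
  moreover have "open_base_at ?T p {{p}}"
    unfolding open_base_at_def by auto
  moreover have "R (subtopology ?T (topspace ?T - {p}))"
    using property_empty[OF R(1,2)] by simp
  ultimately have "R ?T"
    using R(4)[unfolded Mrowka_W_def, rule_format, of ?T p "{{p}}"] by simp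
  moreover have "continuous_map K ?T (\<lambda>x. p)"
    by simp
  then have "perfect_map K ?T (\<lambda>x. p)"
    using K(1) False continuous_imp_proper_map[of K ?T "\<lambda>x. p"]
    by (simp add: perfect_map_def Hausdorff_imp_kc_space image_constant_conv)
  ultimately show ?thesis
    using R(3) K(2) unfolding perfect_inverse_invariant_def by blast
qed

subsection \<open>Collapsing a compact set\<close>

text \<open>The quotient \<open>T\<close> collapsing \<open>K\<close> is Tychonoff and the quotient
  map is perfect. In \<open>T\<close>, complements of open neighbourhoods of the collapsed point are
  copies of closed sets missing \<open>K\<close>, so (W) applies and \<open>R\<close> is pulled back
  to \<open>Y\<close>.\<close>

lemma property_if_closed_away_from_compact:
  fixes Y :: "'u topology"
  assumes R: "topological_property R" "perfect_inverse_invariant R" "Mrowka_W R"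
    and Y: "Tychonoff_space Y" and K: "compactin Y K" "K \<noteq> {}"
    and away: "\<And>A. closedin Y A \<Longrightarrow> A \<inter> K = {} \<Longrightarrow> R (subtopology Y A)"
  shows "R Y"
proof -
  have crY: "completely_regular_space Y" and HY: "Hausdorff_space Y"
    using Y by (auto simp: Tychonoff_space_def)
  obtain p where p: "p \<in> K"
    using K by blast
  have KY: "K \<subseteq> topspace Y" and clK: "closedin Y K"
    using K(1) HY by (auto simp: compactin_subset_topspace compactin_imp_closedin)
  \<comment> \<open>A point \<open>p\<close> of \<open>K\<close> stands for the collapsed set, so
    the quotient keeps its points in \<open>'u\<close> and \<open>q\<close> fixes everything off
    \<open>K\<close>.\<close>
  define q where "q x = (if x \<in> K then p else x)" for x
  obtain T where T: "quotient_map Y T q"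
    using quotient_topology_exists by blast
  have tT: "topspace T = (topspace Y - K) \<union> {p}"
    using quotient_imp_surjective_map[OF T] KY p unfolding q_def by (auto simp: image_iff)
  have contq: "continuous_map Y T q"
    using T by (rule quotient_imp_continuous_map)
  have closed_iff: "closedin T S \<longleftrightarrow> closedin Y {x \<in> topspace Y. q x \<in> S}" if "S \<subseteq> topspace T" for S
    using T that by (simp add: quotient_map_closedin)
  have closedq: "closed_map Y T q"
    unfolding closed_map_def
  proof (intro allI impI)
    fix F assume F: "closedin Y F"
    \<comment> \<open>The saturation of a closed \<open>F\<close> adds at most \<open>K\<close>,
      which is closed.\<close>
    have "{x \<in> topspace Y. q x \<in> q ` F} = (if F \<inter> K = {} then F else F \<union> K)"
      using closedin_subset[OF F] KY p unfolding q_def by (auto simp: image_iff)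
    moreover have "q ` F \<subseteq> topspace T"
      using closedin_subset[OF F] quotient_imp_surjective_map[OF T] by blast
    ultimately show "closedin T (q ` F)"
      using F clK by (simp add: closed_iff closedin_Un)
  qed
  have fib: "{x \<in> topspace Y. q x = y} = (if y = p then K else {y})" if "y \<in> topspace T" for y
    using that KY p unfolding q_def tT by auto
  have "compactin Y {x \<in> topspace Y. q x = y}" if "y \<in> topspace T" for y
    unfolding fib[OF that] using that K(1) tT by auto
  then have perf: "perfect_map Y T q"
    using contq closedq quotient_imp_surjective_map[OF T] by (simp add: perfect_map_def proper_map_def)
  have "closedin T {y}" if "y \<in> topspace T" for y
  proof -
    have "closedin Y {x \<in> topspace Y. q x = y}"
      unfolding fib[OF that] using that clK tT HY by (auto simp: closedin_Hausdorff_sing_eq)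
    then show ?thesis
      using that closed_iff[of "{y}"] by simp
  qed
  then have t1: "t1_space T"
    by (simp add: t1_space_closedin_singleton)
  have crT: "completely_regular_space T"
    unfolding completely_regular_space_def
  proof (intro allI impI, elim conjE)
    fix S x assume S: "closedin T S" and x: "x \<in> topspace T - S"
    define F where "F = {x \<in> topspace Y. q x \<in> S}"
    have F: "closedin Y F"
      using S closed_iff closedin_subset unfolding F_def by blast
    \<comment> \<open>A function on \<open>Y\<close> descends to \<open>T\<close> only if it is
      constant on \<open>K\<close>; so \<open>K\<close> is placed whole in \<open>D\<close> when
      \<open>x\<close> is the collapsed point and in \<open>E\<close> otherwise.\<close>
    define D where "D = (if x = p then K else {x})"
    define E where "E = (if x = p then F else F \<union> K)"
    have DE: "compactin Y D" "closedin Y E" "disjnt D E"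
      using x K(1) clK F tT unfolding D_def E_def F_def q_def
      by (auto simp: disjnt_iff closedin_Un split: if_splits)
    obtain f :: "'u \<Rightarrow> real" where f: "continuous_map Y (top_of_set {0..1}) f"
      "f ` D \<subseteq> {0}" "f ` E \<subseteq> {1}"
      by (rule Urysohn_completely_regular_closed_compact[OF zero_le_one crY DE(2,1) disjnt_sym[OF DE(3)]])
    have constK: "f y = f p" if "y \<in> K" for y
      using f(2,3) that p unfolding D_def E_def by (cases "x = p") (auto simp: image_subset_iff)
    \<comment> \<open>On \<open>Y\<close>, \<open>f\<close> agrees with \<open>f \<circ> q\<close>,
      so it is itself the descended function.\<close>
    have "continuous_map Y (top_of_set {0..1}) (f \<circ> q)"
      using f(1) by (rule continuous_map_eq) (use constK in \<open>auto simp: q_def\<close>)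
    then have "continuous_map T (top_of_set {0..1}) f"
      using continuous_compose_quotient_map[OF T] by blast
    moreover have "f x = 0"
      using f(2) p unfolding D_def by (auto split: if_splits)
    moreover have "S \<subseteq> E"
      using closedin_subset[OF S] x p KY unfolding E_def F_def tT q_def by auto
    then have "f ` S \<subseteq> {1}"
      using f(3) by blast
    ultimately show "\<exists>f::'u \<Rightarrow> real. continuous_map T (top_of_set {0..1}) f \<and> f x = 0 \<and> f ` S \<subseteq> {1}"
      by blast
  qed
  have tyT: "Tychonoff_space T"
    unfolding Tychonoff_space_def
    using crT t1 completely_regular_imp_regular_space regular_t1_eq_Hausdorff_space by blast
  have RT: "R (subtopology T (topspace T - B))" if B: "openin T B" "p \<in> B" for B
  proof -
    define A where "A = topspace T - B"
    have clA: "closedin T A"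
      using B by (auto simp: A_def)
    have AK: "A \<inter> K = {}" "A \<subseteq> topspace Y"
      using B tT by (auto simp: A_def)
    then have "{x \<in> topspace Y. q x \<in> A} = A"
      using B by (auto simp: A_def q_def)
    then have clYA: "closedin Y A"
      using clA closed_iff closedin_subset by metis
    \<comment> \<open>\<open>A\<close> avoids \<open>p\<close>, hence \<open>K\<close>; there
      \<open>q\<close> is the identity, and \<open>A\<close> carries the same topology in
      \<open>Y\<close> and in \<open>T\<close>.\<close>
    have im: "q x = x" if "x \<in> A" for x
      using that AK by (auto simp: q_def)
    have "homeomorphic_map (subtopology Y A) (subtopology T A) q"
    proof (rule bijective_closed_imp_homeomorphic_map)
      show "continuous_map (subtopology Y A) (subtopology T A) q"
        using contq im by (auto simp: continuous_map_in_subtopology continuous_map_from_subtopology)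
      show "closed_map (subtopology Y A) (subtopology T A) q"
        by (rule closed_map_into_subtopology[OF closed_map_from_subtopology[OF closedq clYA]])
          (use im in auto)
      show "q ` topspace (subtopology Y A) = topspace (subtopology T A)"
        using im AK closedin_subset[OF clA] by auto
      show "inj_on q (topspace (subtopology Y A))"
        using im by (auto simp: inj_on_def)
    qed
    then have "subtopology Y A homeomorphic_space subtopology T A"
      by (rule homeomorphic_map_imp_homeomorphic_space)
    moreover have "R (subtopology Y A)"
      using away clYA AK by blast
    ultimately show ?thesis
      using R(1) unfolding topological_property_def A_def by blast
  qed
  have "R T"
    by (rule R(3)[unfolded Mrowka_W_def, rule_format, of T p "{B. openin T B \<and> p \<in> B}"])
      (use tyT RT tT in \<open>auto simp: open_base_at_def\<close>)
  then show ?thesis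
    using R(2) perf HY unfolding perfect_inverse_invariant_def by blast
qed

subsection \<open>Zero-sets and the Stone-Cech compactification\<close>

lemma zero_set_le:
  assumes "continuous_map X euclideanreal f"
  shows "{x \<in> topspace X. f x \<le> c} \<in> zero_sets X"
proof -
  let ?g = "\<lambda>x. max 0 (min 1 (f x - c))"
  have "continuous_map X euclideanreal ?g"
    by (intro continuous_map_real_max continuous_map_real_min continuous_map_diff assms) auto
  then have "continuous_map X (top_of_set {0..1}) ?g"
    by (auto simp: continuous_map_in_subtopology)
  moreover have "{x \<in> topspace X. f x \<le> c} = {x \<in> topspace X. ?g x = 0}"
    by auto
  ultimately show ?thesis
    unfolding zero_sets_def by (intro CollectI exI[of _ ?g] conjI)
qed

lemma zero_set_ge:
  assumes "continuous_map X euclideanreal f"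
  shows "{x \<in> topspace X. c \<le> f x} \<in> zero_sets X"
  using zero_set_le[OF continuous_map_minus[OF assms], of "-c"] by simp

lemma cozero_set_less:
  assumes "continuous_map X euclideanreal f"
  shows "{x \<in> topspace X. f x < c} \<in> cozero_sets X"
proof -
  have "{x \<in> topspace X. f x < c} = topspace X - {x \<in> topspace X. c \<le> f x}"
    by auto
  then show ?thesis
    using zero_set_ge[OF assms, of c] unfolding cozero_sets_def by blast
qed

lemma zero_setE:
  assumes "Z \<in> zero_sets X"
  obtains f where "continuous_map X euclideanreal f" "\<And>x. x \<in> topspace X \<Longrightarrow> 0 \<le> f x \<and> f x \<le> 1"
    "Z = {x \<in> topspace X. f x = 0}"
proof -
  obtain f where "continuous_map X (top_of_set {0..1}) f" "Z = {x \<in> topspace X. f x = (0::real)}"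
    using assms by (auto simp: zero_sets_def)
  then show thesis
    using that[of f] by (auto simp: continuous_map_in_subtopology Pi_iff)
qed

lemma zero_set_subset: "Z \<in> zero_sets X \<Longrightarrow> Z \<subseteq> topspace X"
  by (auto simp: zero_sets_def)

lemma zero_set_closedin:
  assumes "Z \<in> zero_sets X"
  shows "closedin X Z"
proof -
  obtain f where f: "continuous_map X euclideanreal f" "Z = {x \<in> topspace X. f x = 0}"
    using zero_setE[OF assms] by metis
  then show ?thesis
    using closedin_continuous_map_preimage[OF f(1), of "{0}"] by simp
qed

lemma zero_set_Int:
  assumes "S \<in> zero_sets X" "Z \<in> zero_sets X"
  shows "S \<inter> Z \<in> zero_sets X"
proof -
  obtain f where f: "continuous_map X euclideanreal f" "\<And>x. x \<in> topspace X \<Longrightarrow> 0 \<le> f x \<and> f x \<le> 1"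
    "S = {x \<in> topspace X. f x = 0}"
    using zero_setE[OF assms(1)] by blast
  obtain g where g: "continuous_map X euclideanreal g" "\<And>x. x \<in> topspace X \<Longrightarrow> 0 \<le> g x \<and> g x \<le> 1"
    "Z = {x \<in> topspace X. g x = 0}"
    using zero_setE[OF assms(2)] by blast
  have "S \<inter> Z = {x \<in> topspace X. f x + g x \<le> 0}"
    using f(2) g(2) unfolding f(3) g(3) by force
  then show ?thesis
    using zero_set_le[OF continuous_map_add[OF f(1) g(1)], of 0] by simp
qed

text \<open>The quotient \<open>f / (f + g)\<close> works: its denominator vanishes only at common
  zeros, and there are none.\<close>

lemma disjoint_zero_sets_separated:
  assumes "S \<in> zero_sets X" "Z \<in> zero_sets X" "S \<inter> Z = {}"
  obtains h :: "'a \<Rightarrow> real" where "continuous_map X (top_of_set {0..1}) h"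
    "\<And>x. x \<in> S \<Longrightarrow> h x = 0" "\<And>x. x \<in> Z \<Longrightarrow> h x = 1"
proof -
  obtain f where f: "continuous_map X euclideanreal f" "\<And>x. x \<in> topspace X \<Longrightarrow> 0 \<le> f x \<and> f x \<le> 1"
    "S = {x \<in> topspace X. f x = 0}"
    using zero_setE[OF assms(1)] by blast
  obtain g where g: "continuous_map X euclideanreal g" "\<And>x. x \<in> topspace X \<Longrightarrow> 0 \<le> g x \<and> g x \<le> 1"
    "Z = {x \<in> topspace X. g x = 0}"
    using zero_setE[OF assms(2)] by blast
  have pos: "f x + g x \<noteq> 0" if "x \<in> topspace X" for x
    using f(2)[OF that] g(2)[OF that] assms(3) that unfolding f(3) g(3)
    by (auto simp: add_nonneg_eq_0_iff)
  let ?h = "\<lambda>x. f x / (f x + g x)"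
  have "continuous_map X euclideanreal ?h"
    by (intro continuous_map_real_divide continuous_map_add f(1) g(1) pos)
  moreover have "0 \<le> ?h x \<and> ?h x \<le> 1" if "x \<in> topspace X" for x
    using f(2)[OF that] g(2)[OF that] by (auto simp: divide_le_eq_1)
  ultimately have "continuous_map X (top_of_set {0..1}) ?h"
    by (auto simp: continuous_map_in_subtopology)
  moreover have "?h x = 1" if "x \<in> Z" for x
    using that pos[of x] unfolding g(3) by auto
  moreover have "?h x = 0" if "x \<in> S" for x
    using that f(3) by simp
  ultimately show thesis
    by (intro that[of ?h])
qed

section \<open>Closures in extensions\<close>

lemma extension_topspace:
  assumes "extension_of X Y"
  shows "topspace X \<subseteq> topspace Y"
  using assms unfolding extension_of_def
  by (metis inf_le1 topspace_subtopology)

lemma extension_subtopology: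
  assumes "extension_of X Y" "A \<subseteq> topspace X"
  shows "subtopology Y A = subtopology X A"
proof -
  have "subtopology (subtopology Y (topspace X)) A = subtopology Y A"
    using assms(2) by (simp add: subtopology_subtopology Int_absorb1)
  then show ?thesis
    using assms(1) by (simp add: extension_of_def)
qed

lemma extension_continuous_map:
  assumes "extension_of X Y" "continuous_map Y Z f"
  shows "continuous_map X Z f"
  using assms unfolding extension_of_def by (metis continuous_map_from_subtopology)

lemma extension_closure_Int:
  assumes "extension_of X Y" "closedin X A"
  shows "Y closure_of A \<inter> topspace X = A"
proof -
  have "X closure_of A = topspace X \<inter> Y closure_of A"
    using assms closedin_subset[OF assms(2)] closure_of_subtopology[of Y "topspace X" A]
    unfolding extension_of_def by (simp add: Int_absorb1)
  then show ?thesis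
    using closure_of_closedin[OF assms(2)] by blast
qed

lemma open_subset_closure_dense:
  assumes "extension_of X Y" "openin Y U"
  shows "U \<subseteq> Y closure_of (U \<inter> topspace X)"
  using openin_Int_closure_of_subset[OF assms(2), of "topspace X"] openin_subset[OF assms(2)] assms(1)
  unfolding extension_of_def by auto

text \<open>The set where \<open>G < c\<close> is open, and by density of \<open>X\<close> it lies
  in the closure of its trace on \<open>X\<close>. This is how points outside \<open>X\<close> are
  put into interiors of closures of zero-sets.\<close>

lemma less_subset_interior_closure:
  assumes ext: "extension_of X Y" and G: "continuous_map Y euclideanreal G"
    and t: "t \<in> topspace Y" "G t < c"
  shows "t \<in> Y interior_of (Y closure_of {x \<in> topspace X. G x \<le> c})"
proof -
  let ?U = "{y \<in> topspace Y. G y \<in> {..<c}}"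
  have U: "openin Y ?U"
    by (rule openin_continuous_map_preimage[OF G]) auto
  have "?U \<subseteq> Y closure_of (?U \<inter> topspace X)"
    by (rule open_subset_closure_dense[OF ext U])
  also have "\<dots> \<subseteq> Y closure_of {x \<in> topspace X. G x \<le> c}"
    by (rule closure_of_mono) auto
  finally show ?thesis
    using U t unfolding interior_of_def by blast
qed

lemma compact_Hausdorff_separate:
  assumes "compact_space B" "Hausdorff_space B" "closedin B A" "t \<in> topspace B - A"
  obtains G :: "'a \<Rightarrow> real" where "continuous_map B euclideanreal G" "G t = 0"
    "\<And>y. y \<in> A \<Longrightarrow> G y = 1"
proof -
  have "completely_regular_space B"
    using assms(1,2) compact_Hausdorff_or_regular_imp_normal_space
      normal_imp_completely_regular_space by blast
  then obtain G :: "'a \<Rightarrow> real" where "continuous_map B (top_of_set {0..1}) G" "G t = 0" "G ` A \<subseteq> {1}"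
    using assms(3,4) unfolding completely_regular_space_def by blast
  then show thesis
    using that[of G] by (auto simp: continuous_map_in_subtopology)
qed

section \<open>Zero-sets and maps extended to \<beta>X\<close>

text \<open>A function separating the two zero-sets extends to \<open>bX\<close>, where it is still
  0 on one closure and 1 on the other.\<close>

lemma stone_cech_disjoint_zero_sets:
  assumes sc: "stone_cech X bX" and SZ: "S \<in> zero_sets X" "Z \<in> zero_sets X" "S \<inter> Z = {}"
  shows "bX closure_of S \<inter> bX closure_of Z = {}"
proof -
  obtain h :: "'a \<Rightarrow> real" where h: "continuous_map X (top_of_set {0..1}) h"
    "\<And>x. x \<in> S \<Longrightarrow> h x = 0" "\<And>x. x \<in> Z \<Longrightarrow> h x = 1"
    using disjoint_zero_sets_separated[OF SZ] by blast
  obtain g where g: "continuous_map bX (top_of_set {0..1}) g" "\<And>x. x \<in> topspace X \<Longrightarrow> g x = h x"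
    using sc h(1) unfolding stone_cech_def by blast
  have g': "continuous_map bX euclideanreal g"
    using g(1) by (simp add: continuous_map_in_subtopology)
  have cl: "closedin bX {y \<in> topspace bX. g y = c}" for c
    using closedin_continuous_map_preimage[OF g', of "{c}"] by simp
  have "g t = 0" if "t \<in> bX closure_of S" for t
    by (rule forall_in_closure_of[OF that _ cl]) (use g h zero_set_subset[OF SZ(1)] in auto)
  moreover have "g t = 1" if "t \<in> bX closure_of Z" for t
    by (rule forall_in_closure_of[OF that _ cl]) (use g h zero_set_subset[OF SZ(2)] in auto)
  ultimately show ?thesis
    by fastforce
qed

text \<open>If \<open>t\<close> lay in both closures but not in that of the intersection, cutting
  \<open>S\<close> and \<open>Z\<close> down to a zero-set \<open>?L\<close> around \<open>t\<close>
  missing \<open>S \<inter> Z\<close> would give disjoint zero-sets with \<open>t\<close> in both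
  closures.\<close>

lemma stone_cech_closure_Int:
  assumes sc: "stone_cech X bX" and SZ: "S \<in> zero_sets X" "Z \<in> zero_sets X"
  shows "bX closure_of (S \<inter> Z) = bX closure_of S \<inter> bX closure_of Z"
proof
  show "bX closure_of (S \<inter> Z) \<subseteq> bX closure_of S \<inter> bX closure_of Z"
    by (simp add: closure_of_mono)
  show "bX closure_of S \<inter> bX closure_of Z \<subseteq> bX closure_of (S \<inter> Z)"
  proof (rule subsetI, rule ccontr)
    fix t assume t: "t \<in> bX closure_of S \<inter> bX closure_of Z" "t \<notin> bX closure_of (S \<inter> Z)"
    have ext: "extension_of X bX" and cH: "compact_space bX" "Hausdorff_space bX"
      using sc by (auto simp: stone_cech_def)
    have tb: "t \<in> topspace bX"
      using t(1) closure_of_subset_topspace by fastforce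
    obtain G :: "'a \<Rightarrow> real" where G: "continuous_map bX euclideanreal G" "G t = 0"
      "\<And>y. y \<in> bX closure_of (S \<inter> Z) \<Longrightarrow> G y = 1"
      using compact_Hausdorff_separate[OF cH closedin_closure_of] tb t(2) by (metis DiffI)
    let ?U = "{y \<in> topspace bX. G y \<in> {..<1/2}}"
    let ?L = "{x \<in> topspace X. G x \<le> 1/2}"
    have U: "openin bX ?U"
      by (rule openin_continuous_map_preimage[OF G(1)]) auto
    have L: "?L \<in> zero_sets X"
      using zero_set_le extension_continuous_map[OF ext G(1)] by blast
    have "t \<in> bX closure_of (W \<inter> ?L)" if "W \<in> zero_sets X" "t \<in> bX closure_of W" for W
    proof -
      have "?U \<inter> W \<subseteq> W \<inter> ?L"
        using zero_set_subset[OF that(1)] by auto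
      then have "bX closure_of (?U \<inter> W) \<subseteq> bX closure_of (W \<inter> ?L)"
        by (rule closure_of_mono)
      then show ?thesis
        using openin_Int_closure_of_subset[OF U, of W] that(2) tb G(2) by auto
    qed
    then have "t \<in> bX closure_of (S \<inter> ?L) \<inter> bX closure_of (Z \<inter> ?L)"
      using SZ t(1) by blast
    moreover have "(S \<inter> ?L) \<inter> (Z \<inter> ?L) = {}"
    proof -
      have "S \<inter> Z \<subseteq> bX closure_of (S \<inter> Z)"
        using zero_set_subset[OF SZ(1)] extension_topspace[OF ext] by (intro closure_of_subset) auto
      then show ?thesis
        using G(3) by force
    qed
    ultimately show False
      using stone_cech_disjoint_zero_sets[OF sc zero_set_Int[OF SZ(1) L] zero_set_Int[OF SZ(2) L]]
      by blast
  qed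
qed

text \<open>\<open>stone_cech\<close> extends maps into [0,1], so \<open>Y\<close> is embedded in a
  cube and the coordinates are extended one by one; hence the larger type of
  \<open>C\<close>.\<close>

lemma stone_cech_extend_embedding:
  fixes X Y :: "'u topology"
  assumes sc: "stone_cech X bX" and ext: "extension_of X Y" and Y: "Tychonoff_space Y"
  obtains C :: "(('u \<Rightarrow> real) \<Rightarrow> real) topology" and e F
  where "compact_space C" "Hausdorff_space C" "embedding_map Y C e" "continuous_map bX C F"
    "\<And>x. x \<in> topspace X \<Longrightarrow> F x = e x"
proof -
  obtain K :: "('u \<Rightarrow> real) set" and e
    where e: "embedding_map Y (product_topology (\<lambda>f. top_of_set {0..1::real}) K) e"
    using completely_regular_space_cube_embedding Y unfolding Tychonoff_space_def by blast
  let ?C = "product_topology (\<lambda>f. top_of_set {0..1::real}) K"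
  have ce: "continuous_map Y ?C e"
    using e homeomorphic_imp_continuous_map continuous_map_into_fulltopology unfolding embedding_map_def by blast
  have "\<exists>g. continuous_map bX (top_of_set {0..1}) g \<and> (\<forall>x\<in>topspace X. g x = e x k)" if "k \<in> K" for k
  proof -
    have "continuous_map Y (top_of_set {0..1}) (\<lambda>x. e x k)"
      using ce that by (simp add: continuous_map_componentwise)
    then have "continuous_map X (top_of_set {0..1}) (\<lambda>x. e x k)"
      by (rule extension_continuous_map[OF ext])
    then show ?thesis
      using sc unfolding stone_cech_def by blast
  qed
  then obtain G where G: "\<And>k. k \<in> K \<Longrightarrow> continuous_map bX (top_of_set {0..1}) (G k)"
    "\<And>k x. k \<in> K \<Longrightarrow> x \<in> topspace X \<Longrightarrow> G k x = e x k"
    by metis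
  \<comment> \<open>Points of the cube take the value \<open>undefined\<close> off \<open>K\<close>.
    The restriction makes \<open>F t\<close> such a point, so that \<open>F\<close> and
    \<open>e\<close> agree on \<open>X\<close> as functions on the whole index type.\<close>
  define F where "F t = (\<lambda>k\<in>K. G k t)" for t
  show thesis
  proof
    show "compact_space ?C" "Hausdorff_space ?C"
      by (auto simp: compact_space_product_topology Hausdorff_space_product_topology
          compact_space_subtopology Hausdorff_space_subtopology)
    show "embedding_map Y ?C e"
      by (rule e)
    show "continuous_map bX ?C F"
      unfolding continuous_map_componentwise F_def using G(1) by auto
    show "F x = e x" if "x \<in> topspace X" for x
    proof -
      have "e x \<in> extensional K"
        using ce that extension_topspace[OF ext]
        by (auto simp: continuous_map_componentwise)
      then show ?thesis
        using G(2) that by (auto simp: F_def fun_eq_iff extensional_def)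
    qed
  qed
qed

lemma property_b_imp_a:
  assumes "property_b P X Y"
  shows "property_a P X Y"
  unfolding property_a_def
proof (intro ballI impI)
  fix S Z assume SZ: "S \<in> zero_sets X" "Z \<in> zero_sets X" and w: "within_P_cozero P X (S \<inter> Z)"
  have "Y closure_of (S \<inter> Z) - topspace X = (Y closure_of S \<inter> Y closure_of Z) - topspace X"
    using assms SZ unfolding property_b_def by blast
  moreover have "Y closure_of (S \<inter> Z) \<subseteq> topspace X"
    using assms zero_set_Int[OF SZ] w unfolding property_b_def by blast
  ultimately show "Y closure_of S \<inter> Y closure_of Z \<subseteq> topspace X"
    by blast
qed

subsection \<open>The extension \<open>\<zeta>\<close>\<close>

locale zeta_extension =
  fixes P :: "'u topology \<Rightarrow> bool" and X bX :: "'u topology"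
  assumes compactness_like_P: "compactness_like P"
    and Tychonoff_X: "Tychonoff_space X"
    and locally_P_X: "locally_property P X"
    and not_P_X: "\<not> P X"
    and stone_cech_bX: "stone_cech X bX"
begin

abbreviation L where "L \<equiv> lambda_P P X bX"

abbreviation \<zeta> where "\<zeta> \<equiv> zeta_P P X bX"

section \<open>\<open>P\<close> on closed subsets\<close>

lemma P_conditions:
  "topological_property P" "clopen_hereditary P" "finitely_additive P"
  "perfect_invariant P" "perfect_inverse_invariant P" "Mrowka_W P"
  using compactness_like_P by (auto simp: compactness_like_def perfect_property_def)

lemma bX_conditions: "extension_of X bX" "compact_space bX" "Hausdorff_space bX"
  using stone_cech_bX by (auto simp: stone_cech_def)

lemma Hausdorff_X: "Hausdorff_space X"
  using Tychonoff_X by (simp add: Tychonoff_space_def)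

lemma X_subset_bX: "topspace X \<subseteq> topspace bX"
  using extension_topspace[OF bX_conditions(1)] .

text \<open>In a finite universe \<open>X\<close> would be compact and so have \<open>P\<close>.
  Infinity makes sums available.\<close>

lemma infinite_universe: "infinite (UNIV :: 'u set)"
proof
  assume "finite (UNIV :: 'u set)"
  then have "compact_space X"
    unfolding compact_space_def by (metis finite_imp_compactin finite_subset subset_UNIV order_refl)
  then show False
    using compact_imp_property[OF P_conditions(1,2,5,6)] Hausdorff_X not_P_X by blast
qed

lemma P_closed_subset:
  fixes Y :: "'u topology"
  assumes "Hausdorff_space Y" "closedin Y B" "B \<subseteq> A" "P (subtopology Y A)"
  shows "P (subtopology Y B)"
proof -
  have "closedin (subtopology Y A) B"
    using assms by (simp add: closedin_subset_topspace closedin_subset)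
  then have "P (subtopology (subtopology Y A) B)"
    by (rule closed_hereditary[OF infinite_universe P_conditions(1,2,5)
          Hausdorff_space_subtopology[OF assms(1)] assms(4)])
  then show ?thesis
    using assms(3) by (simp add: subtopology_subtopology Int_absorb1)
qed

lemma P_Union_closed:
  assumes "finite \<F>" "\<And>A. A \<in> \<F> \<Longrightarrow> closedin X A \<and> P (subtopology X A)"
  shows "P (subtopology X (\<Union>\<F>))"
  using assms
proof (induction \<F> rule: finite_induct)
  case empty
  then show ?case
    using property_empty[OF P_conditions(1,2)] by simp
next
  case (insert A \<F>)
  have "P (subtopology X (A \<union> \<Union>\<F>))"
    by (rule closed_additive[OF infinite_universe P_conditions(3,4) Hausdorff_X])
      (use insert in \<open>auto intro: closedin_Union\<close>)
  then show ?case
    by simp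
qed

section \<open>The set \<lambda> in \<beta>X\<close>

lemma in_lambda:
  assumes "continuous_map bX euclideanreal G" "t \<in> topspace bX" "G t < c"
    and "P (subtopology X {x \<in> topspace X. G x \<le> c})"
  shows "t \<in> L"
  using less_subset_interior_closure[OF bX_conditions(1) assms(1-3)] assms(4)
    zero_set_le[OF extension_continuous_map[OF bX_conditions(1) assms(1)], of c]
  unfolding lambda_P_def by blast

text \<open>Local \<open>P\<close> gives an open \<open>U\<close> around \<open>x\<close> whose
  closure has \<open>P\<close>. With \<open>V\<close> open in \<open>bX\<close> and of trace
  \<open>U\<close>, a function that is 0 at \<open>x\<close> and 1 off \<open>V\<close> cuts out a
  zero-set inside \<open>U\<close>.\<close>

lemma X_subset_lambda: "topspace X \<subseteq> L"
proof
  fix x assume x: "x \<in> topspace X"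
  obtain U where U: "openin X U" "x \<in> U" and PU: "P (subtopology X (X closure_of U))"
    using locally_P_X x unfolding locally_property_def by blast
  obtain V where V: "openin bX V" "U = V \<inter> topspace X"
    using U(1) bX_conditions(1) unfolding extension_of_def by (metis openin_subtopology)
  have "closedin bX (topspace bX - V)" "x \<in> topspace bX - (topspace bX - V)"
    using V U x X_subset_bX by auto
  then obtain G :: "'u \<Rightarrow> real" where G: "continuous_map bX euclideanreal G" "G x = 0"
    "\<And>y. y \<in> topspace bX - V \<Longrightarrow> G y = 1"
    using compact_Hausdorff_separate[OF bX_conditions(2,3)] by blast
  let ?Z = "{x \<in> topspace X. G x \<le> 1/2}"
  have "?Z \<subseteq> U"
  proof
    fix z assume z: "z \<in> ?Z"
    show "z \<in> U"
    proof (rule ccontr)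
      assume "z \<notin> U"
      then have "G z = 1"
        using z X_subset_bX V by (intro G(3)) auto
      then show False
        using z by simp
    qed
  qed
  then have "?Z \<subseteq> X closure_of U"
    using closure_of_subset[OF openin_subset[OF U(1)]] by blast
  moreover have "closedin X ?Z"
    using zero_set_closedin zero_set_le extension_continuous_map[OF bX_conditions(1) G(1)] by blast
  ultimately have "P (subtopology X ?Z)"
    using P_closed_subset[OF Hausdorff_X _ _ PU] by blast
  then show "x \<in> L"
    using in_lambda[OF G(1), of x "1/2"] G(2) x X_subset_bX by auto
qed

lemma openin_lambda: "openin bX L"
  unfolding lambda_P_def by auto

lemma P_if_closure_subset_lambda:
  assumes A: "closedin X A" and sub: "bX closure_of A \<subseteq> L"
  shows "P (subtopology X A)"
proof -
  define \<Z> where "\<Z> = {Z \<in> zero_sets X. P (subtopology X Z)}"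
  define I where "I Z = bX interior_of (bX closure_of Z)" for Z
  have "compactin bX (bX closure_of A)"
    using bX_conditions(2) by (intro closedin_compact_space) auto
  moreover have "L = \<Union>(I ` \<Z>)"
    unfolding lambda_P_def \<Z>_def I_def by blast
  moreover have "\<forall>U\<in>I ` \<Z>. openin bX U"
    unfolding I_def by simp
  ultimately obtain \<G> where "finite \<G>" "\<G> \<subseteq> I ` \<Z>" "bX closure_of A \<subseteq> \<Union>\<G>"
    using sub unfolding compactin_def by metis
  then obtain \<F> where F: "\<F> \<subseteq> \<Z>" "finite \<F>" "bX closure_of A \<subseteq> (\<Union>Z\<in>\<F>. I Z)"
    by (metis finite_subset_image)
  \<comment> \<open>The \<open>bX\<close>-closure of a zero-set meets \<open>X\<close> in the
    zero-set itself, so the finite cover in \<open>bX\<close> becomes a cover of \<open>A\<close> by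
    sets having \<open>P\<close>.\<close>
  have "A \<subseteq> \<Union>\<F>"
  proof
    fix a assume a: "a \<in> A"
    have "a \<in> bX closure_of A"
      using a closure_of_subset[of A bX] closedin_subset[OF A] X_subset_bX by blast
    then obtain Z where Z: "Z \<in> \<F>" "a \<in> bX closure_of Z"
      using F(3) interior_of_subset[of bX] unfolding I_def by blast
    moreover have "closedin X Z"
      using Z F(1) zero_set_closedin unfolding \<Z>_def by blast
    ultimately show "a \<in> \<Union>\<F>"
      using extension_closure_Int[OF bX_conditions(1)] a closedin_subset[OF A] by blast
  qed
  moreover have "P (subtopology X (\<Union>\<F>))"
    using F zero_set_closedin by (intro P_Union_closed) (auto simp: \<Z>_def)
  ultimately show ?thesis
    using P_closed_subset[OF Hausdorff_X A] by blast
qed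

text \<open>Otherwise \<open>P_if_closure_subset_lambda\<close> for the whole of \<open>X\<close>
  gives \<open>P X\<close>. The collapse needs a nonempty remainder.\<close>

lemma remainder_nonempty: "topspace bX - L \<noteq> {}"
proof
  assume "topspace bX - L = {}"
  then have "bX closure_of (topspace X) \<subseteq> L"
    using closure_of_subset_topspace by fast
  then have "P (subtopology X (topspace X))"
    by (intro P_if_closure_subset_lambda) auto
  then show False
    using not_P_X by simp
qed

section \<open>Membership of \<zeta>\<close>

lemma topspace_zeta: "topspace \<zeta> = topspace X \<union> (topspace bX - L)"
  using X_subset_bX by (auto simp: zeta_P_def)

lemma remainder_zeta: "topspace \<zeta> - topspace X = topspace bX - L"
  using X_subset_lambda by (auto simp: topspace_zeta)

lemma zeta_closure:
  assumes "A \<subseteq> topspace X"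
  shows "\<zeta> closure_of A = topspace \<zeta> \<inter> bX closure_of A"
proof -
  have "(topspace X \<union> (topspace bX - L)) \<inter> A = A"
    using assms by auto
  then show ?thesis
    unfolding topspace_zeta by (simp add: zeta_P_def closure_of_subtopology)
qed

lemma extension_zeta: "extension_of X \<zeta>"
proof -
  have "subtopology \<zeta> (topspace X) = subtopology bX (topspace X)"
    by (simp add: zeta_P_def subtopology_subtopology Int_absorb1)
  moreover have "\<zeta> closure_of topspace X = topspace \<zeta>"
    using zeta_closure[OF order_refl] bX_conditions(1) X_subset_bX
    by (auto simp: extension_of_def topspace_zeta)
  ultimately show ?thesis
    using bX_conditions(1) by (simp add: extension_of_def)
qed

lemma Tychonoff_zeta: "Tychonoff_space \<zeta>"
proof -
  have "completely_regular_space bX"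
    using bX_conditions compact_Hausdorff_or_regular_imp_normal_space
      normal_imp_completely_regular_space by blast
  then show ?thesis
    using bX_conditions(3) unfolding Tychonoff_space_def zeta_P_def
    by (simp add: completely_regular_space_subtopology Hausdorff_space_subtopology)
qed

lemma compactin_remainder: "compactin \<zeta> (topspace bX - L)"
proof -
  have "compactin bX (topspace bX - L)"
    using bX_conditions(2) openin_lambda by (intro closedin_compact_space) auto
  then show ?thesis
    by (simp add: zeta_P_def compactin_subtopology)
qed

lemma zeta_in_Ext: "\<zeta> \<in> Ext X"
  using extension_zeta Tychonoff_zeta compactin_remainder by (simp add: Ext_def remainder_zeta)

text \<open>Serves \<open>P\<close> and \<open>Q\<close> alike: for \<open>P\<close> the hypothesis
  \<open>RA\<close> is \<open>P_if_closure_subset_lambda\<close>, for \<open>Q\<close> it is closed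
  heredity in \<open>X\<close>.\<close>

lemma zeta_has_property:
  assumes R: "topological_property R" "perfect_inverse_invariant R" "Mrowka_W R"
    and RA: "\<And>A. closedin X A \<Longrightarrow> bX closure_of A \<subseteq> L \<Longrightarrow> R (subtopology X A)"
  shows "R \<zeta>"
proof (rule property_if_closed_away_from_compact[OF R Tychonoff_zeta compactin_remainder remainder_nonempty])
  fix A assume A: "closedin \<zeta> A" "A \<inter> (topspace bX - L) = {}"
  have AX: "A \<subseteq> topspace X"
    using closedin_subset[OF A(1)] A(2) by (auto simp: topspace_zeta)
  have "closedin (subtopology \<zeta> (topspace X)) A"
    using A(1) AX by (simp add: closedin_subset_topspace)
  then have "closedin X A"
    using extension_zeta by (simp add: extension_of_def)
  \<comment> \<open>A point of this closure outside \<open>L\<close> belongs to \<zeta>, hence to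
    \<open>A\<close>, which is closed there; but \<open>A\<close> lies in \<open>X\<close>, inside
    \<open>L\<close>.\<close>
  moreover have "bX closure_of A \<subseteq> L"
    using zeta_closure[OF AX] closure_of_closedin[OF A(1)] AX X_subset_lambda
      closure_of_subset_topspace[of bX A] unfolding topspace_zeta by blast
  ultimately have "R (subtopology X A)"
    by (rule RA)
  then show "R (subtopology \<zeta> A)"
    using extension_subtopology[OF extension_zeta AX] by simp
qed

lemma zeta_in_Ext_P: "\<zeta> \<in> Ext_P P X"
  using zeta_in_Ext zeta_has_property[OF P_conditions(1,5,6) P_if_closure_subset_lambda]
  by (simp add: Ext_P_def)

lemma zeta_in_Ext_Q:
  assumes Q: "topological_property Q" "clopen_hereditary Q" "perfect_inverse_invariant Q" "Mrowka_W Q"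
    and "Q X"
  shows "\<zeta> \<in> Ext_P Q X"
  using zeta_in_Ext
    zeta_has_property[OF Q(1,3,4) closed_hereditary[OF infinite_universe Q(1-3) Hausdorff_X \<open>Q X\<close>]]
  by (simp add: Ext_P_def)

section \<open>The inclusion of X extended to \<beta>X\<close>

text \<open>The target is left general: it is a cube for comparison with an arbitrary
  \<open>Y\<close>, and \<open>bX\<close> with identity maps for minimality.\<close>

lemma remainder_image:
  fixes e F :: "'u \<Rightarrow> 'c"
  assumes Y: "Y \<in> Ext_P P X" and C: "compact_space C" "Hausdorff_space C"
    and e: "embedding_map Y C e" and F: "continuous_map bX C F"
    and Fe: "\<And>x. x \<in> topspace X \<Longrightarrow> F x = e x"
    and t: "t \<in> topspace bX - L"
  shows "F t \<in> e ` (topspace Y - topspace X)"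
proof (rule ccontr)
  assume nin: "F t \<notin> e ` (topspace Y - topspace X)"
  have ext: "extension_of X Y" and HY: "Hausdorff_space Y" and PY: "P Y"
    and cpt: "compactin Y (topspace Y - topspace X)"
    using Y by (auto simp: Ext_P_def Ext_def Tychonoff_space_def)
  have ce: "continuous_map Y C e"
    using e homeomorphic_imp_continuous_map continuous_map_into_fulltopology
    unfolding embedding_map_def by blast
  have "closedin C (e ` (topspace Y - topspace X))"
    using image_compactin[OF cpt ce] C(2) compactin_imp_closedin by blast
  moreover have "F t \<in> topspace C - e ` (topspace Y - topspace X)"
    using nin t continuous_map_image_subset_topspace[OF F] by auto
  ultimately obtain G :: "'c \<Rightarrow> real" where G: "continuous_map C euclideanreal G" "G (F t) = 0"
    "\<And>y. y \<in> e ` (topspace Y - topspace X) \<Longrightarrow> G y = 1"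
    using compact_Hausdorff_separate[OF C] by blast
  let ?Z = "{x \<in> topspace X. (G \<circ> F) x \<le> 1/2}"
  have cGe: "continuous_map Y euclideanreal (G \<circ> e)"
    using ce G(1) by (rule continuous_map_compose)
  \<comment> \<open>\<open>G \<circ> e\<close> is 1 on the remainder of \<open>Y\<close>, so its
    sublevel set in \<open>Y\<close> lies in \<open>X\<close>; being closed in \<open>Y\<close>, it
    inherits \<open>P\<close>.\<close>
  have "?Z = {y \<in> topspace Y. (G \<circ> e) y \<in> {..1/2}}"
    using G(3) Fe extension_topspace[OF ext] by fastforce
  moreover have "closedin Y {y \<in> topspace Y. (G \<circ> e) y \<in> {..1/2}}"
    by (rule closedin_continuous_map_preimage[OF cGe]) auto
  ultimately have "P (subtopology Y ?Z)"
    using closed_hereditary[OF infinite_universe P_conditions(1,2,5) HY PY] by simp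
  moreover have "subtopology Y ?Z = subtopology X ?Z"
    using extension_subtopology[OF ext] by auto
  ultimately have "P (subtopology X ?Z)"
    by simp
  then have "t \<in> L"
    using in_lambda[OF continuous_map_compose[OF F G(1)], of t "1/2"] t G(2) by simp
  with t show False
    by blast
qed

text \<open>By continuity \<open>F\<close> sends the closure of \<open>A\<close> into the closure of
  its image in \<open>C\<close>; as \<open>e\<close> is an embedding, the trace of the latter on
  \<open>Y\<close> is the closure in \<open>Y\<close>.\<close>

lemma closure_transport:
  fixes e F :: "'u \<Rightarrow> 'c"
  assumes ext: "extension_of X Y" and e: "embedding_map Y C e" and F: "continuous_map bX C F"
    and Fe: "\<And>x. x \<in> topspace X \<Longrightarrow> F x = e x"
    and A: "A \<subseteq> topspace X" and t: "t \<in> bX closure_of A" and y: "y \<in> topspace Y" "F t = e y"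
  shows "y \<in> Y closure_of A"
proof -
  have hom: "homeomorphic_map Y (subtopology C (e ` topspace Y)) e"
    using e by (simp add: embedding_map_def)
  have AY: "A \<subseteq> topspace Y"
    using A extension_topspace[OF ext] by blast
  have "F ` A = e ` A"
    using A Fe by (auto simp: image_iff subset_iff)
  then have "e y \<in> C closure_of (e ` A)"
    using continuous_map_image_closure_subset[OF F, of A] t y(2) by force
  moreover have "e ` topspace Y \<inter> e ` A = e ` A"
    using AY by auto
  ultimately have "e y \<in> subtopology C (e ` topspace Y) closure_of (e ` A)"
    using y(1) by (simp add: closure_of_subtopology)
  then have "e y \<in> e ` (Y closure_of A)"
    using homeomorphic_map_closure_of[OF hom AY] by simp
  moreover have "inj_on e (topspace Y)"
    using hom by (rule homeomorphic_imp_injective_map)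
  ultimately show ?thesis
    using y(1) closure_of_subset_topspace[of Y A] by (meson inj_on_image_mem_iff)
qed

text \<open>Otherwise \<open>t\<close> lies in the closure of a zero-set of \<open>X\<close> missing
  \<open>x\<close>, and transport puts \<open>x\<close> in its closure in \<open>Y\<close>, which
  adds no point of \<open>X\<close> to it.\<close>

lemma image_in_X:
  fixes e F :: "'u \<Rightarrow> 'c"
  assumes ext: "extension_of X Y" and e: "embedding_map Y C e" and F: "continuous_map bX C F"
    and Fe: "\<And>x. x \<in> topspace X \<Longrightarrow> F x = e x"
    and t: "t \<in> topspace bX" and x: "x \<in> topspace X" "F t = e x"
  shows "t = x"
proof (rule ccontr)
  assume "t \<noteq> x"
  then have "closedin bX {x}" "t \<in> topspace bX - {x}"
    using t x(1) X_subset_bX bX_conditions(3) by (auto simp: closedin_Hausdorff_sing_eq)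
  then obtain G :: "'u \<Rightarrow> real" where G: "continuous_map bX euclideanreal G" "G t = 0"
    "\<And>y. y \<in> {x} \<Longrightarrow> G y = 1"
    using compact_Hausdorff_separate[OF bX_conditions(2,3)] by blast
  let ?A = "{z \<in> topspace X. G z \<le> 1/2}"
  have "t \<in> bX closure_of ?A"
    using less_subset_interior_closure[OF bX_conditions(1) G(1) t, of "1/2"] G(2)
      interior_of_subset[of bX] by auto
  moreover have "x \<in> topspace Y"
    using x(1) extension_topspace[OF ext] by blast
  ultimately have "x \<in> Y closure_of ?A"
    using closure_transport[OF ext e F Fe, of ?A] x(2) by blast
  moreover have "closedin X ?A"
    using zero_set_closedin zero_set_le extension_continuous_map[OF bX_conditions(1) G(1)] by blast
  ultimately have "x \<in> ?A"
    using extension_closure_Int[OF ext] x(1) by blast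
  then show False
    using G(3) by simp
qed

section \<open>Largest, minimal and optimal\<close>

lemma zeta_largest:
  assumes Y: "Y \<in> Ext_P P X"
  shows "ext_le X Y \<zeta>"
proof -
  have ext: "extension_of X Y" and ty: "Tychonoff_space Y"
    using Y by (auto simp: Ext_P_def Ext_def)
  obtain C :: "(('u \<Rightarrow> real) \<Rightarrow> real) topology" and e F
    where C: "compact_space C" "Hausdorff_space C" and e: "embedding_map Y C e"
      and F: "continuous_map bX C F" and Fe: "\<And>x. x \<in> topspace X \<Longrightarrow> F x = e x"
    using stone_cech_extend_embedding[OF stone_cech_bX ext ty] by blast
  have hom: "homeomorphic_map Y (subtopology C (e ` topspace Y)) e"
    using e by (simp add: embedding_map_def)
  then obtain r where r: "homeomorphic_maps Y (subtopology C (e ` topspace Y)) e r"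
    using homeomorphic_map_maps by blast
  have "F ` topspace \<zeta> \<subseteq> e ` topspace Y"
    using remainder_image[OF Y C e F Fe] Fe extension_topspace[OF ext]
    unfolding topspace_zeta by blast
  moreover have "continuous_map \<zeta> C F"
    unfolding zeta_P_def by (rule continuous_map_from_subtopology[OF F])
  ultimately have "continuous_map \<zeta> (subtopology C (e ` topspace Y)) F"
    by (auto simp: continuous_map_in_subtopology)
  then have "continuous_map \<zeta> Y (r \<circ> F)"
    using r continuous_map_compose unfolding homeomorphic_maps_def by blast
  moreover have "(r \<circ> F) x = x" if "x \<in> topspace X" for x
    using r Fe that extension_topspace[OF ext] by (auto simp: homeomorphic_maps_def)
  ultimately show ?thesis
    unfolding ext_le_def by blast
qed

text \<open>A smaller \<open>Y\<close> is itself a subspace of \<open>bX\<close>, so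
  \<open>remainder_image\<close> with identity maps says that \<open>Y\<close> contains the whole
  remainder of \<zeta>.\<close>

lemma zeta_minimal: "\<zeta> \<in> Min_P P X"
proof -
  have False if Y: "Y \<in> Ext_P P X" and sub: "topspace Y \<subset> topspace \<zeta>"
    "subtopology \<zeta> (topspace Y) = Y" for Y
  proof -
    have "topspace Y \<subseteq> topspace X \<union> (topspace bX - L)"
      using sub(1) by (simp add: topspace_zeta)
    then have "subtopology bX (topspace Y) = Y"
      using sub(2) by (simp add: zeta_P_def subtopology_subtopology Int_absorb1)
    then have "embedding_map Y bX id"
      by (simp add: embedding_map_def)
    then have "topspace bX - L \<subseteq> topspace Y"
      using remainder_image[OF Y bX_conditions(2,3), of id id] by auto
    moreover have "topspace X \<subseteq> topspace Y"
      using Y extension_topspace by (auto simp: Ext_P_def Ext_def)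
    ultimately show False
      using sub(1) by (auto simp: topspace_zeta)
  qed
  then show ?thesis
    using zeta_in_Ext_P by (auto simp: Min_P_def)
qed

text \<open>As \<zeta> is largest, some \<open>f\<close> from \<zeta> to \<open>T\<close> fixes
  \<open>X\<close>. Followed by the identity back to the coarser \<zeta>, it fixes a dense set and
  so is the identity; thus the topologies agree.\<close>

lemma zeta_optimal: "\<zeta> \<in> Opt_P P X"
proof -
  have "T = \<zeta>" if T: "T \<in> Ext_P P X" and top: "topspace T = topspace \<zeta>"
    and finer: "\<And>U. openin \<zeta> U \<Longrightarrow> openin T U" for T
  proof -
    obtain f where f: "continuous_map \<zeta> T f" and fx: "\<And>x. x \<in> topspace X \<Longrightarrow> f x = x"
      using zeta_largest[OF T] unfolding ext_le_def by blast
    have "continuous_map T \<zeta> id"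
      using top finer by (auto simp: continuous_map_def openin_subset Int_absorb1 Collect_conj_eq)
    then have cf: "continuous_map \<zeta> \<zeta> f"
      using continuous_map_compose[OF f] by fastforce
    have id: "f y = y" if "y \<in> topspace \<zeta>" for y
    proof (rule forall_in_closure_of_eq[OF _ _ cf])
      show "y \<in> \<zeta> closure_of (topspace X)"
        using that extension_zeta by (simp add: extension_of_def)
      show "Hausdorff_space \<zeta>"
        using Tychonoff_zeta by (simp add: Tychonoff_space_def)
      show "continuous_map \<zeta> \<zeta> (\<lambda>y. y)"
        by simp
    qed (use fx in auto)
    have "openin \<zeta> U" if U: "openin T U" for U
    proof -
      have "{x \<in> topspace \<zeta>. f x \<in> U} = U"
        using id openin_subset[OF U] top by auto
      then show ?thesis
        using openin_continuous_map_preimage[OF f U] by simp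
    qed
    then show ?thesis
      using finer by (auto simp: topology_eq)
  qed
  then show ?thesis
    using zeta_minimal by (auto simp: Opt_P_def)
qed

section \<open>Properties (a) and (b)\<close>

text \<open>\<open>Z\<close> and the complement of \<open>C\<close> are disjoint zero-sets. A
  separating function extends to \<open>bX\<close> and vanishes on the closure of \<open>Z\<close>;
  its sublevel set in \<open>X\<close> at 1/2 is inside \<open>C\<close>, so has
  \<open>P\<close>.\<close>

lemma within_P_closure_subset_lambda:
  assumes Z: "Z \<in> zero_sets X" and w: "within_P_cozero P X Z"
  shows "bX closure_of Z \<subseteq> L"
proof -
  obtain C where C: "C \<in> cozero_sets X" "Z \<subseteq> C" "P (subtopology X (X closure_of C))"
    using w unfolding within_P_cozero_def by blast
  obtain D where D: "D \<in> zero_sets X" "C = topspace X - D"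
    using C(1) unfolding cozero_sets_def by blast
  obtain h :: "'u \<Rightarrow> real" where h: "continuous_map X (top_of_set {0..1}) h"
    "\<And>x. x \<in> Z \<Longrightarrow> h x = 0" "\<And>x. x \<in> D \<Longrightarrow> h x = 1"
    using disjoint_zero_sets_separated[OF Z D(1)] C(2) D(2) by blast
  obtain g where g: "continuous_map bX (top_of_set {0..1}) g" "\<And>x. x \<in> topspace X \<Longrightarrow> g x = h x"
    using stone_cech_bX h(1) unfolding stone_cech_def by blast
  have cg: "continuous_map bX euclideanreal g"
    using g(1) by (simp add: continuous_map_in_subtopology)
  let ?W = "{x \<in> topspace X. g x \<le> 1/2}"
  have "?W \<subseteq> C"
    using h(3) g(2) D(2) by force
  then have "?W \<subseteq> X closure_of C"
    using closure_of_subset[of C X] D(2) by blast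
  moreover have "closedin X ?W"
    using zero_set_closedin zero_set_le extension_continuous_map[OF bX_conditions(1) cg] by blast
  ultimately have PW: "P (subtopology X ?W)"
    using P_closed_subset[OF Hausdorff_X _ _ C(3)] by blast
  show ?thesis
  proof
    fix t assume t: "t \<in> bX closure_of Z"
    have cl: "closedin bX {y \<in> topspace bX. g y = 0}"
      using closedin_continuous_map_preimage[OF cg, of "{0}"] by simp
    have "g t = 0"
      by (rule forall_in_closure_of[OF t _ cl]) (use g(2) h(2) zero_set_subset[OF Z] in auto)
    then show "t \<in> L"
      using in_lambda[OF cg _ _ PW] t closure_of_subset_topspace[of bX Z] by auto
  qed
qed

lemma zeta_property_b: "property_b P X \<zeta>"
  unfolding property_b_def
proof (intro conjI ballI impI)
  fix S Z assume SZ: "S \<in> zero_sets X" "Z \<in> zero_sets X"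
  have "S \<subseteq> topspace X" "Z \<subseteq> topspace X" "S \<inter> Z \<subseteq> topspace X"
    using SZ zero_set_subset by blast+
  then show "\<zeta> closure_of (S \<inter> Z) - topspace X = \<zeta> closure_of S \<inter> \<zeta> closure_of Z - topspace X"
    using stone_cech_closure_Int[OF stone_cech_bX SZ] by (auto simp: zeta_closure)
next
  fix Z assume Z: "Z \<in> zero_sets X" "within_P_cozero P X Z"
  then show "\<zeta> closure_of Z \<subseteq> topspace X"
    using within_P_closure_subset_lambda[OF Z] zero_set_subset[OF Z(1)]
    by (auto simp: zeta_closure topspace_zeta)
qed

text \<open>Both clauses of (b) speak only of what closures add outside \<open>X\<close>, and a
  homeomorphism fixing \<open>X\<close> preserves this.\<close>

lemma ext_equiv_imp_property_b:
  assumes ext: "extension_of X Y" and equ: "ext_equiv X Y \<zeta>"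
  shows "property_b P X Y"
proof -
  obtain h where h: "homeomorphic_map Y \<zeta> h" and hx: "\<And>x. x \<in> topspace X \<Longrightarrow> h x = x"
    using equ unfolding ext_equiv_def by blast
  have XY: "topspace X \<subseteq> topspace Y"
    using extension_topspace[OF ext] .
  have inj: "inj_on h (topspace Y)"
    using h by (rule homeomorphic_imp_injective_map)
  have cl: "y \<in> Y closure_of A \<longleftrightarrow> h y \<in> \<zeta> closure_of A" if "A \<subseteq> topspace X" "y \<in> topspace Y" for A y
  proof -
    have "h ` A = A"
      using hx that(1) by (force simp: image_iff subset_iff)
    then have "\<zeta> closure_of A = h ` (Y closure_of A)"
      using homeomorphic_map_closure_of[OF h, of A] that(1) XY by auto
    then show ?thesis
      using inj that(2) closure_of_subset_topspace[of Y A] by (simp add: inj_on_image_mem_iff)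
  qed
  \<comment> \<open>By injectivity no point outside \<open>X\<close> is sent into \<open>X\<close>,
    where every point is already its own image.\<close>
  have inX: "y \<in> topspace X \<longleftrightarrow> h y \<in> topspace X" if "y \<in> topspace Y" for y
    using hx that XY inj by (metis inj_onD subsetD)
  have clY: "Y closure_of A - topspace X = {y \<in> topspace Y. h y \<in> \<zeta> closure_of A - topspace X}"
    if "A \<subseteq> topspace X" for A
    using cl[OF that] inX closure_of_subset_topspace[of Y A] by blast
  note b = zeta_property_b[unfolded property_b_def]
  show ?thesis
    unfolding property_b_def
  proof (intro conjI ballI impI)
    fix S Z assume SZ: "S \<in> zero_sets X" "Z \<in> zero_sets X"
    then have sub: "S \<subseteq> topspace X" "Z \<subseteq> topspace X" "S \<inter> Z \<subseteq> topspace X"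
      using zero_set_subset by blast+
    have "\<zeta> closure_of (S \<inter> Z) - topspace X = \<zeta> closure_of S \<inter> \<zeta> closure_of Z - topspace X"
      using b SZ by blast
    then show "Y closure_of (S \<inter> Z) - topspace X = Y closure_of S \<inter> Y closure_of Z - topspace X"
      using clY[OF sub(1)] clY[OF sub(2)] clY[OF sub(3)] by blast
  next
    fix Z assume Z: "Z \<in> zero_sets X" "within_P_cozero P X Z"
    then have "\<zeta> closure_of Z \<subseteq> topspace X"
      using b by blast
    then show "Y closure_of Z \<subseteq> topspace X"
      using clY[OF zero_set_subset[OF Z(1)]] by blast
  qed
qed

lemma property_a_imp_ext_equiv:
  assumes Y: "Y \<in> Ext_P P X" and a: "property_a P X Y"
  shows "ext_equiv X Y \<zeta>"
proof -
  have ext: "extension_of X Y" and ty: "Tychonoff_space Y"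
    using Y by (auto simp: Ext_P_def Ext_def)
  have XY: "topspace X \<subseteq> topspace Y"
    using extension_topspace[OF ext] .
  obtain C :: "(('u \<Rightarrow> real) \<Rightarrow> real) topology" and e F
    where C: "compact_space C" "Hausdorff_space C" and e: "embedding_map Y C e"
      and F: "continuous_map bX C F" and Fe: "\<And>x. x \<in> topspace X \<Longrightarrow> F x = e x"
    using stone_cech_extend_embedding[OF stone_cech_bX ext ty] by blast
  have hom: "homeomorphic_map Y (subtopology C (e ` topspace Y)) e"
    using e by (simp add: embedding_map_def)
  have inj: "inj_on e (topspace Y)"
    using hom by (rule homeomorphic_imp_injective_map)
  \<comment> \<open>Points over the remainder of \<open>Y\<close> avoid \<open>L\<close>: otherwise
    (a), with both zero-sets equal to \<open>?Z\<close>, contradicts that \<open>y\<close> lies in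
    the closure of \<open>?Z\<close>.\<close>
  have in_zeta: "t \<in> topspace bX - L" if t: "t \<in> topspace bX" and y: "y \<in> topspace Y - topspace X" "F t = e y" for t y
  proof (rule ccontr)
    assume "t \<notin> topspace bX - L"
    then obtain Z' where Z': "Z' \<in> zero_sets X" "P (subtopology X Z')"
      "t \<in> bX interior_of (bX closure_of Z')"
      using t unfolding lambda_P_def by blast
    define I where "I = bX interior_of (bX closure_of Z')"
    have "closedin bX (topspace bX - I)" "t \<in> topspace bX - (topspace bX - I)"
      using Z'(3) t by (auto simp: I_def)
    then obtain G :: "'u \<Rightarrow> real" where G: "continuous_map bX euclideanreal G" "G t = 0"
      "\<And>y. y \<in> topspace bX - I \<Longrightarrow> G y = 1"
      using compact_Hausdorff_separate[OF bX_conditions(2,3)] by blast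
    have cG: "continuous_map X euclideanreal G"
      using extension_continuous_map[OF bX_conditions(1) G(1)] .
    \<comment> \<open>The levels 1/3 and 1/2 put \<open>?Z\<close> inside the cozero-set
      \<open>?C\<close> and the closure of \<open>?C\<close> inside \<open>?W\<close>, itself inside
      \<open>Z'\<close>, which has \<open>P\<close>.\<close>
    let ?Z = "{x \<in> topspace X. G x \<le> 1/3}"
    let ?C = "{x \<in> topspace X. G x < 1/2}"
    let ?W = "{x \<in> topspace X. G x \<le> 1/2}"
    have Z: "?Z \<in> zero_sets X" and W: "closedin X ?W"
      using zero_set_le[OF cG] zero_set_closedin by blast+
    have "X closure_of ?C \<subseteq> ?W"
      by (rule closure_of_minimal[OF _ W]) auto
    moreover have "?W \<subseteq> I"
      using G(3) X_subset_bX by force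
    then have "?W \<subseteq> Z'"
      using interior_of_subset[of bX "bX closure_of Z'"] extension_closure_Int[OF bX_conditions(1) zero_set_closedin[OF Z'(1)]]
      unfolding I_def by blast
    ultimately have "P (subtopology X (X closure_of ?C))"
      using P_closed_subset[OF Hausdorff_X closedin_closure_of _ Z'(2)] by auto
    moreover have "?Z \<subseteq> ?C"
      by auto
    ultimately have "within_P_cozero P X ?Z"
      using cozero_set_less[OF cG] unfolding within_P_cozero_def by blast
    then have "Y closure_of ?Z \<subseteq> topspace X"
      using a Z unfolding property_a_def by (metis inf.idem)
    moreover have "t \<in> bX closure_of ?Z"
      using less_subset_interior_closure[OF bX_conditions(1) G(1) t, of "1/3"] G(2)
        interior_of_subset[of bX] by auto
    then have "y \<in> Y closure_of ?Z"
      using closure_transport[OF ext e F Fe, of ?Z] y by blast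
    ultimately show False
      using y(1) by blast
  qed
  \<comment> \<open>Distinct remainder points have disjoint zero-sets around them. If both points
    lay over \<open>y\<close>, the closures in \<open>Y\<close> would share \<open>y\<close>,
    against (a): the empty intersection is within the empty cozero-set.\<close>
  have inj_rem: "t = t'" if t: "t \<in> topspace bX - L" "t' \<in> topspace bX - L" and eq: "F t = F t'" for t t'
  proof (rule ccontr)
    assume "t \<noteq> t'"
    obtain y where y: "y \<in> topspace Y - topspace X" "F t = e y"
      using remainder_image[OF Y C e F Fe t(1)] by blast
    have "closedin bX {t'}" "t \<in> topspace bX - {t'}"
      using t \<open>t \<noteq> t'\<close> bX_conditions(3) by (auto simp: closedin_Hausdorff_sing_eq)
    then obtain G :: "'u \<Rightarrow> real" where G: "continuous_map bX euclideanreal G" "G t = 0"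
      "\<And>y. y \<in> {t'} \<Longrightarrow> G y = 1"
      using compact_Hausdorff_separate[OF bX_conditions(2,3)] by blast
    have cG: "continuous_map X euclideanreal G"
      using extension_continuous_map[OF bX_conditions(1) G(1)] .
    let ?S = "{x \<in> topspace X. G x \<le> 1/3}"
    \<comment> \<open>Written with \<open>- G\<close> so that
      \<open>less_subset_interior_closure\<close> applies to it at \<open>t'\<close>.\<close>
    let ?Z = "{x \<in> topspace X. - G x \<le> - 2/3}"
    have SZ: "?S \<in> zero_sets X" "?Z \<in> zero_sets X"
      using zero_set_le[OF cG] zero_set_le[OF continuous_map_minus[OF cG]] by blast+
    have "t \<in> bX closure_of ?S"
      using less_subset_interior_closure[OF bX_conditions(1) G(1), of t "1/3"] G(2) t(1)
        interior_of_subset[of bX] by auto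
    then have "y \<in> Y closure_of ?S"
      using closure_transport[OF ext e F Fe, of ?S] y by blast
    moreover have "t' \<in> bX closure_of ?Z"
      using less_subset_interior_closure[OF bX_conditions(1) continuous_map_minus[OF G(1)], of t' "- 2/3"]
        G(3) t(2) interior_of_subset[of bX] by auto
    then have "y \<in> Y closure_of ?Z"
      using closure_transport[OF ext e F Fe, of ?Z] y eq by auto
    moreover have "within_P_cozero P X (?S \<inter> ?Z)"
    proof -
      have "?S \<inter> ?Z = {}"
        by auto
      moreover have "{} \<in> cozero_sets X"
        using cozero_set_less[of X "\<lambda>x. 0" 0] by simp
      moreover have "P (subtopology X (X closure_of {}))"
        using property_empty[OF P_conditions(1,2)] by simp
      ultimately show ?thesis
        unfolding within_P_cozero_def by (metis order_refl)
    qed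
    ultimately show False
      using a SZ y(1) unfolding property_a_def by blast
  qed
  \<comment> \<open>\<zeta> contains the whole preimage of the copy of \<open>Y\<close> under
    \<open>F\<close>; this makes the restriction of \<open>F\<close> onto and closed.\<close>
  have pre: "t \<in> topspace \<zeta>" if "t \<in> topspace bX" "F t \<in> e ` topspace Y" for t
    using that in_zeta[OF that(1)] image_in_X[OF ext e F Fe that(1)] by (auto simp: topspace_zeta)
  have tz: "topspace \<zeta> \<subseteq> topspace bX"
    using X_subset_bX by (auto simp: topspace_zeta)
  have surj: "F ` topspace \<zeta> = e ` topspace Y"
  proof
    show "F ` topspace \<zeta> \<subseteq> e ` topspace Y"
      using remainder_image[OF Y C e F Fe] Fe XY unfolding topspace_zeta by blast
    show "e ` topspace Y \<subseteq> F ` topspace \<zeta>"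
    proof -
      \<comment> \<open>The image of \<open>F\<close> is closed and contains the copy of
        \<open>X\<close>, which is dense in that of \<open>Y\<close>; so it covers the
        latter.\<close>
      have "closed_map bX C F"
        using continuous_imp_closed_map[OF F bX_conditions(2) C(2)] .
      then have "closedin C (F ` topspace bX)"
        by (simp add: closed_map_def)
      moreover have "e ` topspace X \<subseteq> F ` topspace bX"
        using Fe X_subset_bX by (metis (no_types, lifting) image_subset_iff image_eqI subsetD)
      ultimately have "C closure_of (e ` topspace X) \<subseteq> F ` topspace bX"
        by (intro closure_of_minimal)
      moreover have "e ` (Y closure_of topspace X) \<subseteq> C closure_of (e ` topspace X)"
        using continuous_map_image_closure_subset
          [OF continuous_map_into_fulltopology[OF homeomorphic_imp_continuous_map[OF hom]]] .
      ultimately have sub: "e ` topspace Y \<subseteq> F ` topspace bX"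
        using ext unfolding extension_of_def by (metis subset_trans)
      show ?thesis
      proof
        fix z assume z: "z \<in> e ` topspace Y"
        then obtain t where "t \<in> topspace bX" "z = F t"
          using sub by blast
        then show "z \<in> F ` topspace \<zeta>"
          using pre[of t] z by blast
      qed
    qed
  qed
  have "homeomorphic_map \<zeta> (subtopology C (e ` topspace Y)) F"
  proof (rule bijective_closed_imp_homeomorphic_map)
    show "continuous_map \<zeta> (subtopology C (e ` topspace Y)) F"
    proof -
      have "continuous_map \<zeta> C F"
        unfolding zeta_P_def by (rule continuous_map_from_subtopology[OF F])
      then show ?thesis
        using surj by (simp add: continuous_map_in_subtopology image_subset_iff_funcset[symmetric])
    qed
    show "F ` topspace \<zeta> = topspace (subtopology C (e ` topspace Y))"
      using surj homeomorphic_imp_surjective_map[OF hom] by (rule trans)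
    show "inj_on F (topspace \<zeta>)"
    proof (rule inj_onI)
      fix s t assume st: "s \<in> topspace \<zeta>" "t \<in> topspace \<zeta>" "F s = F t"
      then have "s \<in> topspace bX" "t \<in> topspace bX"
        using tz by auto
      then show "s = t"
        using st inj_rem image_in_X[OF ext e F Fe] Fe unfolding topspace_zeta by (metis Un_iff)
    qed
    show "closed_map \<zeta> (subtopology C (e ` topspace Y)) F"
      unfolding closed_map_def
    proof (intro allI impI)
      fix A assume "closedin \<zeta> A"
      then obtain B where B: "closedin bX B" "A = B \<inter> topspace \<zeta>"
        unfolding topspace_zeta by (auto simp: zeta_P_def closedin_subtopology)
      have "closedin C (F ` B)"
        using continuous_imp_closed_map[OF F bX_conditions(2) C(2)] B(1) by (simp add: closed_map_def)
      \<comment> \<open>By \<open>pre\<close>, cutting \<open>B\<close> down to \<zeta> amounts to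
        cutting its image down to the copy of \<open>Y\<close>.\<close>
      moreover have "F ` A = F ` B \<inter> e ` topspace Y"
        using pre surj closedin_subset[OF B(1)] unfolding B(2) by blast
      ultimately show "closedin (subtopology C (e ` topspace Y)) (F ` A)"
        unfolding closedin_subtopology by blast
    qed
  qed
  then obtain r where r: "homeomorphic_maps \<zeta> (subtopology C (e ` topspace Y)) F r"
    using homeomorphic_map_maps by blast
  then have "homeomorphic_map (subtopology C (e ` topspace Y)) \<zeta> r"
    using homeomorphic_map_maps homeomorphic_maps_sym by blast
  then have "homeomorphic_map Y \<zeta> (r \<circ> e)"
    using hom homeomorphic_map_compose by blast
  moreover have "(r \<circ> e) x = x" if "x \<in> topspace X" for x
    using r Fe that by (metis Un_iff comp_apply homeomorphic_maps_def topspace_zeta)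
  ultimately show ?thesis
    unfolding ext_equiv_def by blast
qed

end

theorem theorem4p37:
  fixes P Q :: "'u topology \<Rightarrow> bool" and X bX :: "'u topology"
  assumes "compactness_like_pair P Q"
    and "Tychonoff_space X" and "locally_property P X" and "\<not> P X" and "Q X"
    and "stone_cech X bX"
  shows "largest_ext X (Ext_PQ P Q X) (zeta_P P X bX) \<and>
         largest_ext X (Min_PQ P Q X) (zeta_P P X bX) \<and>
         largest_ext X (Opt_PQ P Q X) (zeta_P P X bX) \<and>
         (\<forall>Y\<in>Ext_PQ P Q X.
            (ext_equiv X Y (zeta_P P X bX) \<longleftrightarrow> property_a P X Y) \<and>
            (ext_equiv X Y (zeta_P P X bX) \<longleftrightarrow> property_b P X Y))"
proof -
  interpret zeta_extension P X bX
    using assms by unfold_locales (auto simp: compactness_like_pair_def)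
  have Q: "\<zeta> \<in> Ext_P Q X"
    using assms by (intro zeta_in_Ext_Q) (auto simp: compactness_like_pair_def)
  have sub: "Opt_P P X \<subseteq> Min_P P X" "Min_P P X \<subseteq> Ext_P P X"
    by (auto simp: Opt_P_def Min_P_def)
  \<comment> \<open>All three collections lie inside \<open>Ext_P P X\<close>, over which
    \<open>zeta_largest\<close> ranges; what remains is membership of \<zeta>.\<close>
  have largest: "largest_ext X \<E> \<zeta>" if "\<zeta> \<in> \<E>" "\<E> \<subseteq> Ext_P P X" for \<E>
    using that zeta_largest by (auto simp: largest_ext_def)
  have "largest_ext X (Ext_PQ P Q X) \<zeta>"
    by (rule largest) (use Q zeta_in_Ext_P in \<open>auto simp: Ext_PQ_def\<close>)
  moreover have "largest_ext X (Min_PQ P Q X) \<zeta>"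
    by (rule largest) (use Q zeta_minimal sub in \<open>auto simp: Min_PQ_def\<close>)
  moreover have "largest_ext X (Opt_PQ P Q X) \<zeta>"
    by (rule largest) (use Q zeta_optimal sub in \<open>auto simp: Opt_PQ_def\<close>)
  moreover have "ext_equiv X Y \<zeta> \<longleftrightarrow> property_a P X Y" "ext_equiv X Y \<zeta> \<longleftrightarrow> property_b P X Y"
    if "Y \<in> Ext_PQ P Q X" for Y
  proof -
    have Y: "Y \<in> Ext_P P X" and ext: "extension_of X Y"
      using that by (auto simp: Ext_PQ_def Ext_P_def Ext_def)
    show "ext_equiv X Y \<zeta> \<longleftrightarrow> property_a P X Y" "ext_equiv X Y \<zeta> \<longleftrightarrow> property_b P X Y"
      using ext_equiv_imp_property_b[OF ext] property_b_imp_a property_a_imp_ext_equiv[OF Y] by blast+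
  qed
  ultimately show ?thesis
    by blast
qed

end
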